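(* Let $A$ be a Banach algebra that has a left approximate identity $\{e_\lambda\}_{\lambda\in\Lambda}$ of bound $M\geq 1$, let $X$ be a Banach space, and let $\pi$ be a continuous representation of $A$ on $X$. Let $S$ be a non-empty subset of $X$ such that $\lim_\lambda \pi(e_\lambda)s=s$ uniformly on $S$, and suppose that $S$ is bounded or that $\{e_\lambda\}_{\lambda\in\Lambda}$ is commutative. Choose a unital Banach superalgebra $B$ of $A$ such that $\pi$ extends to a continuous unital representation, again denoted by $\pi$, of $B$ on $X$. Then, for every $\epsilon>0$, every $\delta>0$, every $r$ such that $0<r<(M+1)^{-1}$, every integer $n_0\geq 1$, and every sequence $\{\alpha_n\}_{n=1}^\infty$ in $(1,\infty)$ such that $\lim_{n\to\infty}\alpha_n=\infty$, there exist $a\in A$ and maps $x_n:S\to X$ for $n\geq 1$ such that: (1) $s=\pi(a^n)x_n(s)$ for all $n\geq 1$ and $s\in S$; (2) $\|a\|\leq M$; (3) for all $n\geq 1$, $x_n$ is a uniformly continuous homeomorphism of $S$ onto $x_n(S)$, with the restricted map $\pi(a^n):x_n(S)\to S$ as its inverse; (4) (a) $\|s-x_n(s)\|\leq\epsilon$ for all $n$ such that $1\leq n\leq n_0$ and for all $s\in S$; (b) $\|x_n(s)\|\leq\alpha_n^n\max(\|s\|,\delta)$ for all $n\geq 1$ and $s\in S$; (5) (a) if $s_1,s_2\in S$ are such that $s_1+s_2\in S$, then $x_n(s_1+s_2)=x_n(s_1)+x_n(s_2)$ for all $n\geq 1$; (b) if $\mu$ is a scalar and $s\in S$ are such that $\mu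 s\in S$, then $x_n(\mu s)=\mu x_n(s)$ for all $n\geq 1$; (6) there exists a sequence $\{u_i\}_{i=1}^\infty$ in $\{e_\lambda:\lambda\in\Lambda\}$ such that: (a) $a=\sum_{i=1}^\infty r(1-r)^{i-1}u_i$ is an element of the closed convex hull of $\{u_i: i\geq 1\}$ in $A$; (b) for every $k\geq 0$, the element $b_k=(1-r)^k1_B+\sum_{i=1}^k r(1-r)^{i-1}u_i$ of $B$ is an element of the convex hull of $\{1_B,u_1,\ldots,u_k\}$ in $B$ that is invertible in $B$, $b_k^{-1}$ is an element of the unital Banach subalgebra of $B$ that is generated by $\{u_1,\ldots,u_k\}$, and $x_n(s)=\lim_{k\to\infty}\pi(b_k^{-n})s$ for all $n\geq 1$ and $s\in S$; (c) there exists a chain $\lambda_1\leq\lambda_2\leq\lambda_3\leq\ldots$ in $\Lambda$ such that $u_k=e_{\lambda_k}$ for all $k\geq 1$; if $\Lambda$ does not have a largest element, one can require that $\lambda_1<\lambda_2<\lambda_3<\ldots$; (7) (a) if $S$ is bounded, then $x_n(S)$ is bounded for all $n\geq 1$; (b) if $S$ is totally bounded, then $x_n(S)$ is totally bounded for all $n\geq 1$; (c) $\lim_\lambda\pi(e_\lambda)x_n(s)=x_n(s)$ uniformly on $S$ for all $n\geq 1$.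
   Context: All algebras and vector spaces are over $\mathbb F=\mathbb R$ or $\mathbb F=\mathbb C$. The unit element $1_B$ of a unital normed algebra $B$ has norm $1$. A left approximate identity of bound $M$ for $A$ is a net $\{e_\lambda\}_{\lambda\in\Lambda}$ in $A$ with $\|e_\lambda\|\leq M$ for all $\lambda$ and $\lim_\lambda e_\lambda a=a$ for all $a\in A$; it is commutative if $e_\lambda e_{\lambda'}=e_{\lambda'}e_\lambda$ for all $\lambda,\lambda'\in\Lambda$. A continuous representation of $A$ on $X$ is a norm-continuous algebra homomorphism $\pi$ from $A$ into the bounded operators on $X$; a representation of a unital algebra is called unital if it maps the unit to the identity operator. "$\lim_\lambda\pi(e_\lambda)s=s$ uniformly on $S$" means that for every $\eta>0$ there is $\lambda_0\in\Lambda$ with $\|\pi(e_\lambda)s-s\|<\eta$ for all $\lambda\geq\lambda_0$ and all $s\in S$; the uniform limit in (7)(c) is understood likewise. A unital Banach superalgebra $B$ of $A$ is a unital Banach algebra containing $A$ as a closed subalgebra, with the norm of $A$ being the restricted norm. The unital Banach subalgebra of $B$ generated by a set is the smallest closed subalgebra of $B$ containing that set and $1_B$. In $\Lambda$, $\lambda<\lambda'$ means $\lambda\leq\lambda'$ and $\lambda\neq\lambda'$. *)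

theory Defs
  imports "HOL-Analysis.Analysis"
begin

text \<open>
  The scalar field is a type \<open>'f\<close> of class \<^class>\<open>real_normed_field\<close>. By the Gelfand-Mazur theorem
  the only such fields, up to isometric isomorphism, are the real and the complex numbers, so a
  statement that is polymorphic in \<open>'f\<close> covers exactly these two cases.

  Since HOL-Analysis only provides real normed spaces as a type class, a normed space over \<open>'f\<close> is a
  real normed space together with a scalar multiplication by \<open>'f\<close> that extends \<^const>\<open>scaleR\<close>.
  Completeness is expressed by the class \<^class>\<open>banach\<close>.
\<close>

locale normed_space_over = vector_space scale
  for scale :: "'f::real_normed_field \<Rightarrow> 'v::real_normed_vector \<Rightarrow> 'v" +
  assumes norm_scale: "norm (scale c v) = norm c * norm v"
    and scale_of_real: "scale (of_real t) v = t *\<^sub>R v"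

locale normed_algebra_over = normed_space_over scale
  for scale :: "'f::real_normed_field \<Rightarrow> 'v::real_normed_algebra \<Rightarrow> 'v" +
  assumes scale_mult_left: "scale c v * w = scale c (v * w)"
    and scale_mult_right: "v * scale c w = scale c (v * w)"

lemma normed_algebra_over_scaleR:
  "normed_algebra_over (scaleR :: real \<Rightarrow> 'v::real_normed_algebra \<Rightarrow> 'v)"
  by unfold_locales (simp_all add: scaleR_add_right scaleR_add_left)

lemma normed_algebra_over_times:
  "normed_algebra_over ((*) :: complex \<Rightarrow> complex \<Rightarrow> complex)"
  by unfold_locales (simp_all add: distrib_left distrib_right norm_mult scaleR_conv_of_real)


text \<open>
  A norm-continuous representation. The type \<open>'x \<Rightarrow>\<^sub>L 'x\<close> consists of the bounded real-linear
  operators with the operator norm; linearity of each \<open>\<pi> a\<close> over \<open>'f\<close> is required separately.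
\<close>

locale continuous_representation =
  A: normed_algebra_over scaleA + X: normed_space_over scaleX
  for scaleA :: "'f::real_normed_field \<Rightarrow> 'a::real_normed_algebra \<Rightarrow> 'a"
    and scaleX :: "'f \<Rightarrow> 'x::real_normed_vector \<Rightarrow> 'x" +
  fixes \<pi> :: "'a \<Rightarrow> ('x \<Rightarrow>\<^sub>L 'x)"
  assumes operator_scale: "blinfun_apply (\<pi> a) (scaleX c v) = scaleX c (blinfun_apply (\<pi> a) v)"
    and rep_add: "\<pi> (a + b) = \<pi> a + \<pi> b"
    and rep_scale: "blinfun_apply (\<pi> (scaleA c a)) v = scaleX c (blinfun_apply (\<pi> a) v)"
    and rep_mult: "\<pi> (a * b) = \<pi> a o\<^sub>L \<pi> b"
    and rep_continuous: "continuous_on UNIV \<pi>"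

locale continuous_unital_representation = continuous_representation scaleB scaleX \<pi>
  for scaleB :: "'f::real_normed_field \<Rightarrow> 'b::real_normed_algebra_1 \<Rightarrow> 'b"
    and scaleX :: "'f \<Rightarrow> 'x::real_normed_vector \<Rightarrow> 'x"
    and \<pi> :: "'b \<Rightarrow> ('x \<Rightarrow>\<^sub>L 'x)" +
  assumes rep_one: "\<pi> 1 = id_blinfun"


text \<open>
  The inclusion of the algebra \<open>'a\<close> in the superalgebra \<open>'b\<close> is an isometric homomorphism \<open>\<iota>\<close> with
  closed range. (The class \<^class>\<open>real_normed_algebra_1\<close> contains the requirement that the unit has
  norm \<open>1\<close>.)
\<close>

locale unital_banach_superalgebra =
  A: normed_algebra_over scaleA + B: normed_algebra_over scaleB
  for scaleA :: "'f::real_normed_field \<Rightarrow> 'a::{real_normed_algebra, banach} \<Rightarrow> 'a"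
    and scaleB :: "'f \<Rightarrow> 'b::{real_normed_algebra_1, banach} \<Rightarrow> 'b" +
  fixes \<iota> :: "'a \<Rightarrow> 'b"
  assumes incl_add: "\<iota> (a + b) = \<iota> a + \<iota> b"
    and incl_scale: "\<iota> (scaleA c a) = scaleB c (\<iota> a)"
    and incl_mult: "\<iota> (a * b) = \<iota> a * \<iota> b"
    and norm_incl: "norm (\<iota> a) = norm a"
    and closed_range_incl: "closed (range \<iota>)"

definition unital_banach_subalgebra ::
    "('f::real_normed_field \<Rightarrow> 'b::real_normed_algebra_1 \<Rightarrow> 'b) \<Rightarrow> 'b set \<Rightarrow> bool"
  where "unital_banach_subalgebra scaleB C \<longleftrightarrow>
    module.subspace scaleB C \<and> (\<forall>x\<in>C. \<forall>y\<in>C. x * y \<in> C) \<and> 1 \<in> C \<and> closed C"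

definition invertible_element :: "'b::monoid_mult \<Rightarrow> bool"
  where "invertible_element x \<longleftrightarrow> (\<exists>y. x * y = 1 \<and> y * x = 1)"

text \<open>Only meaningful if \<open>x\<close> is an \<^const>\<open>invertible_element\<close>; then the inverse is unique.\<close>

definition inverse_element :: "'b::monoid_mult \<Rightarrow> 'b"
  where "inverse_element x = (THE y. x * y = 1 \<and> y * x = 1)"

lemma inverse_element_eq:
  assumes "x * y = 1" "y * x = 1"
  shows "inverse_element x = y"
  unfolding inverse_element_def
proof (rule the_equality)
  fix z assume "x * z = 1 \<and> z * x = 1"
  then have "z = (y * x) * z" "y = y * (x * z)"
    using assms by simp_all
  then show "z = y"
    by (simp only: mult.assoc)
qed (use assms in simp)


text \<open>
  Nets are indexed by a set \<open>\<Lambda>\<close> that is directed by a preorder \<open>le\<close>. Limits along the net are limits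
  along the filter generated by its tails, which makes the library's \<^const>\<open>tendsto\<close> and
  \<open>uniform_limit\<close> available.
\<close>

definition directed_set :: "'i set \<Rightarrow> ('i \<Rightarrow> 'i \<Rightarrow> bool) \<Rightarrow> bool"
  where "directed_set \<Lambda> le \<longleftrightarrow> \<Lambda> \<noteq> {} \<and> reflp_on \<Lambda> le \<and> transp_on \<Lambda> le \<and>
    (\<forall>\<kappa>\<in>\<Lambda>. \<forall>\<mu>\<in>\<Lambda>. \<exists>\<nu>\<in>\<Lambda>. le \<kappa> \<nu> \<and> le \<mu> \<nu>)"

definition net_filter :: "'i set \<Rightarrow> ('i \<Rightarrow> 'i \<Rightarrow> bool) \<Rightarrow> 'i filter"
  where "net_filter \<Lambda> le = (INF \<kappa>\<in>\<Lambda>. principal {\<mu>\<in>\<Lambda>. le \<kappa> \<mu>})"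

lemma eventually_net_filter:
  assumes "directed_set \<Lambda> le"
  shows "eventually P (net_filter \<Lambda> le) \<longleftrightarrow> (\<exists>\<kappa>\<in>\<Lambda>. \<forall>\<mu>\<in>\<Lambda>. le \<kappa> \<mu> \<longrightarrow> P \<mu>)"
proof -
  have "\<exists>\<nu>\<in>\<Lambda>. principal {\<rho>\<in>\<Lambda>. le \<nu> \<rho>} \<le> inf (principal {\<rho>\<in>\<Lambda>. le \<kappa> \<rho>}) (principal {\<rho>\<in>\<Lambda>. le \<mu> \<rho>})"
    if km: "\<kappa> \<in> \<Lambda>" "\<mu> \<in> \<Lambda>" for \<kappa> \<mu>
  proof -
    obtain \<nu> where \<nu>: "\<nu> \<in> \<Lambda>" "le \<kappa> \<nu>" "le \<mu> \<nu>"
      using assms km unfolding directed_set_def by blast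
    have "le \<kappa> \<rho> \<and> le \<mu> \<rho>" if "\<rho> \<in> \<Lambda>" "le \<nu> \<rho>" for \<rho>
      using assms km \<nu> that unfolding directed_set_def by (meson transp_onD)
    then show ?thesis
      using \<nu>(1) by auto
  qed
  then show ?thesis
    using assms unfolding net_filter_def directed_set_def
    by (subst eventually_INF_base) (auto simp: eventually_principal)
qed

lemma uniform_limit_net_filter:
  assumes "directed_set \<Lambda> le"
  shows "uniform_limit S f l (net_filter \<Lambda> le) \<longleftrightarrow>
    (\<forall>\<eta>>0. \<exists>\<kappa>\<in>\<Lambda>. \<forall>\<mu>\<in>\<Lambda>. le \<kappa> \<mu> \<longrightarrow> (\<forall>s\<in>S. dist (f \<mu> s) (l s) < \<eta>))"
  by (simp add: uniform_limit_iff eventually_net_filter[OF assms])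

definition left_approximate_identity ::
    "'i set \<Rightarrow> ('i \<Rightarrow> 'i \<Rightarrow> bool) \<Rightarrow> ('i \<Rightarrow> 'a::real_normed_algebra) \<Rightarrow> real \<Rightarrow> bool"
  where "left_approximate_identity \<Lambda> le e M \<longleftrightarrow> directed_set \<Lambda> le \<and>
    (\<forall>\<kappa>\<in>\<Lambda>. norm (e \<kappa>) \<le> M) \<and>
    (\<forall>a. ((\<lambda>\<kappa>. e \<kappa> * a) \<longlongrightarrow> a) (net_filter \<Lambda> le))"

definition commutative_net :: "'i set \<Rightarrow> ('i \<Rightarrow> 'a::times) \<Rightarrow> bool"
  where "commutative_net \<Lambda> e \<longleftrightarrow> (\<forall>\<kappa>\<in>\<Lambda>. \<forall>\<mu>\<in>\<Lambda>. e \<kappa> * e \<mu> = e \<mu> * e \<kappa>)"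

end

theory Submission
  imports Defs
begin

text \<open>
  This is the Cohen factorization construction. Put \<open>b\<^sub>0 = 1\<close> and
  \<open>b\<^sub>k\<^sub>+\<^sub>1 = b\<^sub>k + r (1 - r)\<^sup>k (u\<^sub>k\<^sub>+\<^sub>1 - 1)\<close>, so that \<open>b\<^sub>k\<close> converges to \<open>a\<close>. If \<open>u\<^sub>k\<^sub>+\<^sub>1\<close> is far out
  in the net, it almost acts as a left unit on the part of \<open>b\<^sub>k\<close> in the algebra, and \<open>b\<^sub>k\<^sub>+\<^sub>1\<close> inherits
  invertibility from \<open>b\<^sub>k\<close>, with \<open>norm (b\<^sub>k\<^sub>+\<^sub>1\<^sup>-\<^sup>1) \<le> L * norm (b\<^sub>k\<^sup>-\<^sup>1)\<close> for a constant \<open>L\<close>. Since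
  \<open>b\<^sub>k\<^sub>+\<^sub>1\<^sup>-\<^sup>1 - b\<^sub>k\<^sup>-\<^sup>1 = r (1 - r)\<^sup>k b\<^sub>k\<^sub>+\<^sub>1\<^sup>-\<^sup>1 (1 - u\<^sub>k\<^sub>+\<^sub>1) b\<^sub>k\<^sup>-\<^sup>1\<close>, every fixed power \<open>\<pi> (b\<^sub>k\<^sup>-\<^sup>n)\<close> changes as
  little as desired, uniformly on \<open>S\<close>, as soon as \<open>\<pi> (u\<^sub>k\<^sub>+\<^sub>1)\<close> is close to the identity on the sets
  \<open>\<pi> (b\<^sub>k\<^sup>-\<^sup>j) S\<close>. For bounded \<open>S\<close> this holds because \<open>b\<^sub>k\<^sup>-\<^sup>j\<close> is a limit of elements \<open>c 1 + w\<close> with \<open>w\<close> in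
  the algebra; for a commutative net because \<open>u\<^sub>k\<^sub>+\<^sub>1\<close> commutes with \<open>b\<^sub>k\<^sup>-\<^sup>j\<close>.

  At step \<open>k\<close> only the finitely many powers with \<open>n \<le> n\<^sub>0\<close> or \<open>\<alpha>\<^sub>n < K L\<^sup>k\<^sup>+\<^sup>1 + 1\<close> can be controlled, where
  \<open>K\<close> bounds \<open>\<pi>\<close>. For the other \<open>n\<close>, the crude estimate
  \<open>norm (\<pi> (b\<^sub>k\<^sup>-\<^sup>n) s) \<le> (K L\<^sup>k)\<^sup>n * norm s\<close> is still compatible with the growth condition.
\<close>

section \<open>Inverses in Banach algebras\<close>

lemma (in normed_space_over) bounded_linear_scale: "bounded_linear (scale c)"
proof (rule bounded_linear_intro[where K = "norm c"])
  show "scale c (t *\<^sub>R x) = t *\<^sub>R scale c x" for t x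
    by (simp add: scale_of_real[symmetric] scale_scale mult.commute)
qed (simp_all add: scale_right_distrib norm_scale mult.commute)

lemma (in normed_space_over) subspace_scaleR:
  assumes "subspace C" "x \<in> C"
  shows "t *\<^sub>R x \<in> C"
  using subspace_scale[OF assms, of "of_real t"] by (simp add: scale_of_real)

lemma unital_banach_subalgebra_hull:
  assumes "normed_algebra_over scaleB"
  shows "unital_banach_subalgebra scaleB (unital_banach_subalgebra scaleB hull T)"
proof (rule hull_in)
  interpret normed_algebra_over scaleB by fact
  show "unital_banach_subalgebra scaleB (\<Inter>\<F>)" if "Ball \<F> (unital_banach_subalgebra scaleB)" for \<F>
    using that unfolding unital_banach_subalgebra_def
    by (auto intro!: subspace_Inter closed_Inter)
qed

text \<open>Sums, products and scalar multiples pass to limits. Taking a closure later replaces a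
  separate proof that the scalars plus the embedded algebra form a closed set.\<close>

lemma unital_banach_subalgebra_closure:
  fixes C :: "'b::real_normed_algebra_1 set"
  assumes "normed_algebra_over scaleB" "module.subspace scaleB C"
    and mult: "\<And>x y. x \<in> C \<Longrightarrow> y \<in> C \<Longrightarrow> x * y \<in> C" and "1 \<in> C"
  shows "unital_banach_subalgebra scaleB (closure C)"
proof -
  interpret normed_algebra_over scaleB by fact
  have "x + y \<in> closure C" "x * y \<in> closure C" if xy: "x \<in> closure C" "y \<in> closure C" for x y
  proof -
    obtain f where f: "\<And>n. f n \<in> C" "f \<longlonglongrightarrow> x"
      using xy(1) unfolding closure_sequential by blast
    obtain g where g: "\<And>n. g n \<in> C" "g \<longlonglongrightarrow> y"
      using xy(2) unfolding closure_sequential by blast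
    show "x + y \<in> closure C"
      unfolding closure_sequential
      using f g by (intro exI[of _ "\<lambda>n. f n + g n"]) (auto intro: tendsto_add subspace_add[OF assms(2)])
    show "x * y \<in> closure C"
      unfolding closure_sequential
      using f g by (intro exI[of _ "\<lambda>n. f n * g n"]) (auto intro: tendsto_mult mult)
  qed
  moreover have "scaleB c x \<in> closure C" if "x \<in> closure C" for c x
  proof -
    have "scaleB c ` closure C \<subseteq> closure (scaleB c ` C)"
      by (rule closure_bounded_linear_image_subset[OF bounded_linear_scale])
    also have "\<dots> \<subseteq> closure C"
      using subspace_scale[OF assms(2)] by (intro closure_mono) auto
    finally show ?thesis
      using that by blast
  qed
  moreover have "0 \<in> closure C" "1 \<in> closure C"
    using subspace_0[OF assms(2)] \<open>1 \<in> C\<close> closure_subset by blast+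
  ultimately show ?thesis
    unfolding unital_banach_subalgebra_def subspace_def by simp
qed

lemma unital_banach_subalgebra_power:
  assumes "unital_banach_subalgebra scaleB C" "x \<in> C"
  shows "x ^ n \<in> C"
  using assms by (induction n) (auto simp: unital_banach_subalgebra_def)

text \<open>The inverse is the geometric series in \<open>x\<close>. Its partial sums lie in the
  closed subalgebra \<open>C\<close>, hence so does the inverse; this is what keeps the inverses of
  the construction in the generated subalgebra.\<close>

lemma neumann_inverse:
  fixes x :: "'b::{real_normed_algebra_1, banach}"
  assumes "normed_algebra_over scaleB" and C: "unital_banach_subalgebra scaleB C" "x \<in> C"
    and x: "norm x \<le> q" "q < 1"
  obtains y where "y \<in> C" "(1 - x) * y = 1" "y * (1 - x) = 1" "norm y \<le> 1 / (1 - q)"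
proof -
  interpret normed_algebra_over scaleB by fact
  have q: "0 \<le> q"
    using x(1) norm_ge_zero order_trans by blast
  have le: "norm (x ^ n) \<le> q ^ n" for n
    using norm_power_ineq[of x n] power_mono[OF x(1)] order_trans by fastforce
  have geo: "(\<lambda>n. q ^ n) sums (1 / (1 - q))"
    using geometric_sums[of q] q x(2) by simp
  have nsum: "summable (\<lambda>n. norm (x ^ n))"
    by (rule summable_comparison_test'[OF sums_summable[OF geo], of 0]) (simp add: le)
  define y where "y = (\<Sum>n. x ^ n)"
  have sums: "(\<lambda>n. x ^ n) sums y"
    unfolding y_def by (rule summable_sums[OF summable_norm_cancel[OF nsum]])
  have "(\<lambda>n. x ^ Suc n) sums (y - 1)"
    using sums sums_Suc_iff[of "\<lambda>n. x ^ n"] by simp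
  moreover have "(\<lambda>n. x ^ Suc n) sums (x * y)" "(\<lambda>n. x ^ Suc n) sums (y * x)"
    using sums_mult[OF sums, of x] sums_mult2[OF sums, of x] by (simp_all add: power_commutes)
  ultimately have "x * y = y - 1" "y * x = y - 1"
    by (blast intro: sums_unique2)+
  moreover have "y \<in> C"
  proof (rule closed_sequentially[of C])
    show "closed C" "(\<Sum>i<n. x ^ i) \<in> C" for n
      using C unital_banach_subalgebra_power[OF C]
      by (auto simp: unital_banach_subalgebra_def intro!: subspace_sum)
    show "(\<lambda>n. \<Sum>i<n. x ^ i) \<longlonglongrightarrow> y"
      using sums by (simp add: sums_def)
  qed
  moreover have "norm y \<le> 1 / (1 - q)"
    using norm_sums_le[OF sums geo le] .
  ultimately show ?thesis
    using that by (simp add: algebra_simps)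
qed

text \<open>
  With \<open>v = 1 - r (1 - u)\<close> the new element factors as \<open>b + r t (u - 1) = v (b - x)\<close>, where
  \<open>x = - r v\<^sup>-\<^sup>1 (1 - u) g\<close> is small as soon as \<open>u\<close> nearly acts as a left unit on \<open>g\<close>.
\<close>

lemma perturbed_inverse:
  fixes b y g u :: "'b::{real_normed_algebra_1, banach}"
  assumes alg: "normed_algebra_over scaleB" and C: "unital_banach_subalgebra scaleB C"
    and mem: "u \<in> C" "b \<in> C" "y \<in> C"
    and b: "b = t *\<^sub>R 1 + g" and inv: "b * y = 1" "y * b = 1"
    and r: "0 \<le> r" and q: "norm (r *\<^sub>R (1 - u)) \<le> q" "q < 1"
    and small: "norm y * (r / (1 - q) * norm ((1 - u) * g)) \<le> 1 / 2"
  shows "\<exists>y'\<in>C. (b + (r * t) *\<^sub>R (u - 1)) * y' = 1 \<and> y' * (b + (r * t) *\<^sub>R (u - 1)) = 1 \<and>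
    norm y' \<le> 2 / (1 - q) * norm y"
proof -
  interpret normed_algebra_over scaleB by fact
  have C': "subspace C" "\<And>x y. x \<in> C \<Longrightarrow> y \<in> C \<Longrightarrow> x * y \<in> C" "1 \<in> C"
    using C by (auto simp: unital_banach_subalgebra_def)
  note Cin = C' subspace_diff subspace_scaleR subspace_neg mem
  define w where "w = r *\<^sub>R (1 - u)"
  have "w \<in> C"
    unfolding w_def by (intro Cin)
  \<comment> \<open>In this proof \<open>v\<close> is the inverse of the factor
    \<open>1 - w = 1 - r (1 - u)\<close>, not the factor itself.\<close>
  obtain v where v: "v \<in> C" "(1 - w) * v = 1" "v * (1 - w) = 1" "norm v \<le> 1 / (1 - q)"
    using neumann_inverse[OF alg C \<open>w \<in> C\<close>] q unfolding w_def by metis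
  define x where "x = - (v * w * g)"
  have g: "g = b - t *\<^sub>R 1"
    using b by simp
  have "x \<in> C"
    unfolding x_def g by (intro Cin v \<open>w \<in> C\<close>)
  have "norm x = norm (v * (r *\<^sub>R ((1 - u) * g)))"
    by (simp add: x_def w_def mult.assoc)
  also have "\<dots> \<le> norm v * (r * norm ((1 - u) * g))"
    using norm_mult_ineq[of v "r *\<^sub>R ((1 - u) * g)"] r by simp
  also have "\<dots> \<le> 1 / (1 - q) * (r * norm ((1 - u) * g))"
    using v(4) r by (intro mult_right_mono) auto
  finally have "norm x \<le> r / (1 - q) * norm ((1 - u) * g)"
    by simp
  then have "norm y * norm x \<le> 1 / 2"
    using small mult_left_mono[of "norm x" _ "norm y"] by (meson norm_ge_zero order_trans)
  then have "norm (y * x) \<le> 1 / 2"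
    using norm_mult_ineq order_trans by blast
  moreover have "y * x \<in> C"
    by (intro C' mem \<open>x \<in> C\<close>)
  \<comment> \<open>Since \<open>b * y = 1\<close>, the second factor is
    \<open>b - x = b * (1 - y * x)\<close>, so only \<open>1 - y * x\<close> remains to be inverted.
    The bound \<open>1 / 2\<close> makes its inverse at most \<open>2\<close> in norm, which is the
    numerator of the final estimate.\<close>
  ultimately obtain z where z: "z \<in> C" "(1 - y * x) * z = 1" "z * (1 - y * x) = 1" "norm z \<le> 2"
    using neumann_inverse[OF alg C, of "y * x" "1 / 2"] by auto
  have "b * (1 - y * x) = b - b * y * x"
    by (simp add: right_diff_distrib mult.assoc)
  also have "\<dots> = b + v * w * g"
    by (simp add: inv x_def)
  finally have "(1 - w) * (b * (1 - y * x)) = (1 - w) * b + (1 - w) * v * (w * g)"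
    by (simp add: distrib_left mult.assoc)
  \<comment> \<open>Here \<open>b - g\<close> is the scalar part of \<open>b\<close>, so the
    correction is exactly the perturbation \<open>r t (u - 1)\<close>.\<close>
  also have "\<dots> = b - w * (b - g)"
    unfolding v(2) by (simp add: algebra_simps)
  also have "\<dots> = b + (r * t) *\<^sub>R (u - 1)"
    by (simp add: b w_def algebra_simps)
  finally have b': "b + (r * t) *\<^sub>R (u - 1) = (1 - w) * (b * (1 - y * x))" ..
  have "z * y * v \<in> C"
    by (intro Cin z v)
  moreover have "(1 - w) * (b * (1 - y * x)) * (z * y * v) = (1 - w) * (b * ((1 - y * x) * z) * y) * v"
    by (simp add: mult.assoc)
  then have "(1 - w) * (b * (1 - y * x)) * (z * y * v) = 1"
    by (simp add: z inv v)
  moreover have "z * y * v * ((1 - w) * (b * (1 - y * x))) = z * (y * (v * (1 - w)) * b) * (1 - y * x)"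
    by (simp add: mult.assoc)
  then have "z * y * v * ((1 - w) * (b * (1 - y * x))) = 1"
    by (simp add: z inv v)
  moreover have "norm (z * y * v) \<le> norm z * norm y * norm v"
    by (meson norm_mult_ineq mult_right_mono norm_ge_zero order_trans)
  then have "norm (z * y * v) \<le> 2 * norm y * (1 / (1 - q))"
    using mult_mono[OF mult_right_mono[OF z(4), of "norm y"] v(4)] by simp
  ultimately show ?thesis
    unfolding b' by auto
qed

lemma power_Suc_diff:
  fixes y y' :: "'b::real_normed_algebra_1"
  shows "y' ^ Suc n - y ^ Suc n = y' * (y' ^ n - y ^ n) + (y' - y) * y ^ n"
  by (simp add: algebra_simps)

text \<open>Resolvent identity \<open>y' - y = y' (b - b') y\<close> with
  \<open>b' = b + d (u - 1)\<close>. The factor \<open>1 - u\<close> stands directly before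
  \<open>y\<close>, so the difference is small on every vector whose image under \<open>y\<close> is
  nearly fixed by \<open>u\<close>.\<close>

lemma inverse_perturbation:
  fixes y y' :: "'b::real_normed_algebra_1"
  assumes "b * y = 1" "y' * (b + d *\<^sub>R (u - 1)) = 1"
  shows "y' - y = d *\<^sub>R (y' * ((1 - u) * y))"
proof -
  have "y' * (b + d *\<^sub>R (u - 1)) * y = y' * (b * y) + d *\<^sub>R (y' * (u * y)) - d *\<^sub>R (y' * y)"
    by (simp add: algebra_simps)
  then have "y = y' + d *\<^sub>R (y' * (u * y)) - d *\<^sub>R (y' * y)"
    unfolding assms by simp
  then show ?thesis
    by (simp add: algebra_simps)
qed

section \<open>Convergence\<close>

text \<open>A geometric series dominates the increments uniformly on \<open>S\<close>. The bound
  starts at an index \<open>m\<close> because each exponent is controlled only from some step of the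
  construction on.\<close>

lemma geometric_increments:
  fixes c :: "nat \<Rightarrow> 's \<Rightarrow> 'x::banach"
  assumes "\<And>k s. m \<le> k \<Longrightarrow> s \<in> S \<Longrightarrow> norm (c (Suc k) s - c k s) \<le> \<eta> / 2 ^ Suc k"
  shows geometric_increments_tendsto: "s \<in> S \<Longrightarrow> (\<lambda>k. c k s) \<longlonglongrightarrow> lim (\<lambda>k. c k s)"
    and geometric_increments_le: "s \<in> S \<Longrightarrow> m \<le> k \<Longrightarrow> norm (lim (\<lambda>k. c k s) - c k s) \<le> \<eta> / 2 ^ k"
    and geometric_increments_uniform: "uniform_limit S c (\<lambda>s. lim (\<lambda>k. c k s)) sequentially"
proof -
  \<comment> \<open>The right-hand side is the exact sum of the \<open>j\<close> increment bounds,
    which lets the induction close.\<close>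
  have dist: "norm (c (k + j) s - c k s) \<le> \<eta> / 2 ^ k - \<eta> / 2 ^ (k + j)" if "s \<in> S" "m \<le> k" for s k j
  proof (induction j)
    case (Suc j)
    have "norm (c (Suc (k + j)) s - c k s) \<le> norm (c (Suc (k + j)) s - c (k + j) s) + norm (c (k + j) s - c k s)"
      using norm_triangle_ineq[of "c (Suc (k + j)) s - c (k + j) s" "c (k + j) s - c k s"] by simp
    also have "\<dots> \<le> \<eta> / 2 ^ Suc (k + j) + (\<eta> / 2 ^ k - \<eta> / 2 ^ (k + j))"
      using assms[of "k + j" s] that Suc by (intro add_mono) auto
    also have "\<dots> = \<eta> / 2 ^ k - \<eta> / 2 ^ Suc (k + j)"
      by simp
    finally show ?case
      by simp
  qed simp
  have null: "(\<lambda>k. \<eta> / 2 ^ k) \<longlonglongrightarrow> 0"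
    using tendsto_mult_right_zero[OF LIMSEQ_power_zero[of "1 / 2 :: real"], of \<eta>]
    by (simp add: power_one_over)
  show lim: "(\<lambda>k. c k s) \<longlonglongrightarrow> lim (\<lambda>k. c k s)" if s: "s \<in> S" for s
  proof -
    have "\<eta> \<ge> 0"
    proof -
      have "0 \<le> \<eta> / 2 ^ Suc m"
        using order_trans[OF norm_ge_zero assms[OF order_refl s]] .
      then show ?thesis
        using zero_le_mult_iff[of "\<eta> / 2 ^ Suc m" "2 ^ Suc m"] by simp
    qed
    have "Cauchy (\<lambda>k. c k s)"
    proof (rule CauchyI')
      fix \<theta> :: real assume "\<theta> > 0"
      then have "\<forall>\<^sub>F k in sequentially. \<eta> / 2 ^ k < \<theta>"
        using order_tendstoD(2)[OF null] by blast
      then obtain N where N: "\<And>k. N \<le> k \<Longrightarrow> \<eta> / 2 ^ k < \<theta>"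
        unfolding eventually_sequentially by blast
      have "dist (c k s) (c j s) < \<theta>" if "max N m \<le> k" "k < j" for k j
      proof -
        have "norm (c j s - c k s) \<le> \<eta> / 2 ^ k - \<eta> / 2 ^ j"
          using dist[OF s, of k "j - k"] that by simp
        also have "\<dots> \<le> \<eta> / 2 ^ k"
          using \<open>\<eta> \<ge> 0\<close> by simp
        also have "\<dots> < \<theta>"
          using N that by simp
        finally show ?thesis
          by (simp add: dist_norm norm_minus_commute)
      qed
      then show "\<exists>N. \<forall>k\<ge>N. \<forall>j>k. dist (c k s) (c j s) < \<theta>"
        by blast
    qed
    then show ?thesis
      by (simp add: Cauchy_convergent_iff convergent_LIMSEQ_iff)
  qed
  show le: "norm (lim (\<lambda>k. c k s) - c k s) \<le> \<eta> / 2 ^ k" if s: "s \<in> S" and k: "m \<le> k" for s k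
  proof (rule LIMSEQ_le)
    show "(\<lambda>j. norm (c (j + k) s - c k s)) \<longlonglongrightarrow> norm (lim (\<lambda>k. c k s) - c k s)"
      by (intro tendsto_intros LIMSEQ_ignore_initial_segment lim s)
    show "(\<lambda>j. \<eta> / 2 ^ k - \<eta> / 2 ^ (j + k)) \<longlonglongrightarrow> \<eta> / 2 ^ k"
      using tendsto_diff[OF tendsto_const LIMSEQ_ignore_initial_segment[OF null, of k]] by simp
    show "\<exists>N. \<forall>j\<ge>N. norm (c (j + k) s - c k s) \<le> \<eta> / 2 ^ k - \<eta> / 2 ^ (j + k)"
      using dist[OF s k] by (simp add: add.commute)
  qed
  show "uniform_limit S c (\<lambda>s. lim (\<lambda>k. c k s)) sequentially"
  proof (rule uniform_limitI)
    fix \<theta> :: real assume "\<theta> > 0"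
    then have "\<forall>\<^sub>F k in sequentially. \<eta> / 2 ^ k < \<theta>"
      using order_tendstoD(2)[OF null] by blast
    then show "\<forall>\<^sub>F k in sequentially. \<forall>s\<in>S. dist (c k s) (lim (\<lambda>k. c k s)) < \<theta>"
      using eventually_ge_at_top[of m]
    proof eventually_elim
      case (elim k)
      then show ?case
        using le by (metis dist_norm norm_minus_commute order_le_less_trans)
    qed
  qed
qed

lemma uniformly_continuous_on_uniform_limit:
  fixes f :: "'k \<Rightarrow> 'x::metric_space \<Rightarrow> 'y::metric_space"
  assumes "uniform_limit S f g F" "F \<noteq> bot" "\<And>k. uniformly_continuous_on S (f k)"
  shows "uniformly_continuous_on S g"
  unfolding uniformly_continuous_on_def
proof (intro allI impI)
  fix \<eta> :: real assume "\<eta> > 0"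
  then have "\<forall>\<^sub>F k in F. \<forall>s\<in>S. dist (f k s) (g s) < \<eta> / 3"
    by (intro uniform_limitD[OF assms(1)]) simp
  then obtain k where k: "\<And>s. s \<in> S \<Longrightarrow> dist (f k s) (g s) < \<eta> / 3"
    using eventually_happens'[OF assms(2)] by blast
  obtain d where d: "d > 0" "\<And>s s'. s \<in> S \<Longrightarrow> s' \<in> S \<Longrightarrow> dist s' s < d \<Longrightarrow> dist (f k s') (f k s) < \<eta> / 3"
    using assms(3)[of k] \<open>\<eta> > 0\<close> unfolding uniformly_continuous_on_def
    by (metis divide_pos_pos zero_less_numeral)
  have "dist (g s') (g s) < \<eta>" if "s \<in> S" "s' \<in> S" "dist s' s < d" for s s'
    using k[OF that(1)] k[OF that(2)] d(2)[OF that]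
      dist_triangle3[of "g s'" "g s" "f k s'"] dist_triangle[of "f k s'" "g s" "f k s"] by linarith
  then show "\<exists>d>0. \<forall>s\<in>S. \<forall>s'\<in>S. dist s' s < d \<longrightarrow> dist (g s') (g s) < \<eta>"
    using d(1) by blast
qed

lemma totally_bounded_uniformly_continuous_image:
  fixes f :: "'x::metric_space \<Rightarrow> 'y::metric_space"
  assumes f: "uniformly_continuous_on S f" and S: "totally_bounded S"
  shows "totally_bounded (f ` S)"
  unfolding totally_bounded_metric
proof (intro allI impI)
  fix \<eta> :: real assume "\<eta> > 0"
  then obtain d where d: "d > 0" "\<And>s s'. s \<in> S \<Longrightarrow> s' \<in> S \<Longrightarrow> dist s' s < d \<Longrightarrow> dist (f s') (f s) < \<eta>"
    using f unfolding uniformly_continuous_on_def by metis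
  obtain k where k: "finite k" "S \<subseteq> (\<Union>x\<in>k. {y. dist x y < d / 2})"
    using S d(1) unfolding totally_bounded_metric by (metis half_gt_zero)
  \<comment> \<open>The centres of the finite cover may lie outside \<open>S\<close>, where nothing
    is known about \<open>f\<close>. Each is moved to a point of \<open>S\<close> within
    \<open>d / 2\<close>, hence the halved radius.\<close>
  define p where "p x = (SOME s. s \<in> S \<and> dist x s < d / 2)" for x
  have "f s \<in> (\<Union>x\<in>(\<lambda>x. f (p x)) ` k. {y. dist x y < \<eta>})" if s: "s \<in> S" for s
  proof -
    obtain x where x: "x \<in> k" "dist x s < d / 2"
      using k(2) s by blast
    then have p: "p x \<in> S" "dist x (p x) < d / 2"
      using s someI[of "\<lambda>s. s \<in> S \<and> dist x s < d / 2" s] unfolding p_def by auto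
    have "dist (p x) s < d"
      using dist_triangle_half_r[OF p(2) x(2)] .
    then show ?thesis
      using d(2)[OF s p(1)] x(1) by blast
  qed
  then show "\<exists>k. finite k \<and> f ` S \<subseteq> (\<Union>x\<in>k. {y. dist x y < \<eta>})"
    using k(1) by (intro exI[of _ "(\<lambda>x. f (p x)) ` k"]) blast
qed

text \<open>A partial sum has total weight \<open>W k\<close> below \<open>1\<close> and is not a
  convex combination. Dividing by \<open>W k\<close>, which tends to \<open>1\<close>, repairs this
  without changing the limit.\<close>

lemma sums_in_closure_convex_hull:
  fixes u :: "nat \<Rightarrow> 'a::real_normed_vector"
  assumes a: "(\<lambda>i. w i *\<^sub>R u i) sums a" and w: "w sums 1" "\<And>i. 0 < w i"
  shows "a \<in> closure (convex hull (range u))"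
proof -
  define W where "W k = (\<Sum>i<Suc k. w i)" for k
  have W_pos: "W k > 0" for k
    unfolding W_def using w(2) by (intro sum_pos) auto
  have "(1 / W k) *\<^sub>R (\<Sum>i<Suc k. w i *\<^sub>R u i) \<in> convex hull (range u)" for k
  proof -
    have "(\<Sum>i<Suc k. (w i / W k) *\<^sub>R u i) \<in> convex hull (range u)"
    proof (rule convex_sum)
      show "(\<Sum>i<Suc k. w i / W k) = 1"
        using W_pos[of k] unfolding sum_divide_distrib[symmetric] W_def by simp
      show "0 \<le> w i / W k" "u i \<in> convex hull range u" for i
        using W_pos[of k] w(2)[of i] by (auto intro: hull_inc)
    qed (auto simp: convex_convex_hull)
    then show ?thesis
      by (simp add: scaleR_sum_right del: sum.lessThan_Suc)
  qed
  moreover have "(\<lambda>k. (1 / W k) *\<^sub>R (\<Sum>i<Suc k. w i *\<^sub>R u i)) \<longlonglongrightarrow> (1 / 1) *\<^sub>R a"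
    unfolding W_def
    by (intro tendsto_intros LIMSEQ_Suc[OF a[unfolded sums_def]] LIMSEQ_Suc[OF w(1)[unfolded sums_def]]) simp
  ultimately show ?thesis
    unfolding closure_sequential div_by_1 scaleR_one
    by (intro exI[of _ "\<lambda>k. (1 / W k) *\<^sub>R (\<Sum>i<Suc k. w i *\<^sub>R u i)"]) blast
qed

text \<open>Used with \<open>a = \<alpha> n - 1\<close>: the summand \<open>1\<close> absorbs the
  distance between the limit map and its first controlled approximant.\<close>

lemma power_add_one_ge:
  fixes a :: real
  assumes "0 \<le> a" "1 \<le> n"
  shows "a ^ n + 1 \<le> (a + 1) ^ n"
  using assms(2)
proof (induction n rule: dec_induct)
  case (step n)
  have "a ^ Suc n + 1 \<le> (a + 1) * (a ^ n + 1)"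
    using assms(1) by (simp add: algebra_simps)
  also have "\<dots> \<le> (a + 1) * (a + 1) ^ n"
    using step assms(1) by (intro mult_left_mono) auto
  finally show ?case
    by simp
qed simp

section \<open>Factorization along an approximate identity\<close>

text \<open>Real homogeneity is the scalar rule at \<open>of_real t\<close>. Continuity at
  \<open>0\<close> bounds \<open>\<pi>\<close> on a ball of radius \<open>d\<close>, and rescaling
  to norm \<open>d / 2\<close> gives the constant \<open>2 / d\<close>.\<close>

lemma (in continuous_representation) bounded_linear_rep: "bounded_linear \<pi>"
proof -
  have add: "\<pi> (x + y) = \<pi> x + \<pi> y" for x y
    by (rule rep_add)
  have scaleR: "\<pi> (t *\<^sub>R x) = t *\<^sub>R \<pi> x" for t x
    using rep_scale[of "of_real t" x]
    by (auto intro!: blinfun_eqI simp: A.scale_of_real X.scale_of_real blinfun.scaleR_left)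
  interpret linear \<pi>
    by unfold_locales (simp_all add: add scaleR)
  have "isCont \<pi> 0"
    using rep_continuous by (simp add: continuous_on_eq_continuous_at)
  then obtain d where d: "d > 0" "\<And>x. dist x 0 < d \<Longrightarrow> dist (\<pi> x) (\<pi> 0) < 1"
    unfolding continuous_at_eps_delta by (metis zero_less_one)
  show ?thesis
  proof (rule bounded_linear_intro[where K = "2 / d"])
    show "norm (\<pi> x) \<le> norm x * (2 / d)" for x
    proof (cases "x = 0")
      case False
      have "norm (\<pi> ((d / (2 * norm x)) *\<^sub>R x)) < 1"
        using d(2)[of "(d / (2 * norm x)) *\<^sub>R x"] d(1) False by (simp add: zero)
      then show ?thesis
        using d(1) False by (simp add: scaleR field_simps)
    qed (simp add: zero)
  qed (simp_all add: add scaleR)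
qed

text \<open>The data on which the construction itself rests. \<open>\<epsilon>\<close>,
  \<open>\<delta>\<close>, \<open>\<alpha>\<close> and \<open>n\<^sub>0\<close> enter only through
  the exponent sets and tolerances handed to \<open>factorization_sequence\<close>.\<close>

locale uniform_factorization =
  rep: continuous_unital_representation scaleB scaleX \<pi> +
  sup: unital_banach_superalgebra scaleA scaleB \<iota>
  for scaleA :: "'f::real_normed_field \<Rightarrow> 'a::{real_normed_algebra, banach} \<Rightarrow> 'a"
    and scaleB :: "'f \<Rightarrow> 'b::{real_normed_algebra_1, banach} \<Rightarrow> 'b"
    and scaleX :: "'f \<Rightarrow> 'x::banach \<Rightarrow> 'x"
    and \<pi> :: "'b \<Rightarrow> ('x \<Rightarrow>\<^sub>L 'x)" and \<iota> :: "'a \<Rightarrow> 'b" +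
  fixes \<Lambda> :: "'i set" and le :: "'i \<Rightarrow> 'i \<Rightarrow> bool" and e :: "'i \<Rightarrow> 'a" and M r :: real
    and S :: "'x set"
  assumes lai: "left_approximate_identity \<Lambda> le e M" and M: "1 \<le> M"
    and unif: "uniform_limit S (\<lambda>\<kappa> s. \<pi> (\<iota> (e \<kappa>)) s) (\<lambda>s. s) (net_filter \<Lambda> le)"
    and bounded_or_commutative: "bounded S \<or> commutative_net \<Lambda> e"
    and r_pos: "0 < r" and r_less: "r < 1 / (M + 1)"
begin

abbreviation "net \<equiv> net_filter \<Lambda> le"

text \<open>A bound for \<open>\<pi>\<close>, raised to at least \<open>1\<close> so that it may be
  divided by and inserted into upper estimates.\<close>

definition K :: real where "K = max 1 (onorm \<pi>)"

text \<open>Growth factor of the inverse in one step: \<open>1 / (1 - r * (M + 1))\<close> bounds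
  the inverse of \<open>1 - r (1 - u)\<close>, and \<open>2\<close> bounds that of
  \<open>1 - y * x\<close> in \<open>perturbed_inverse\<close>.\<close>

definition L :: real where "L = 2 / (1 - r * (M + 1))"

lemma directed: "directed_set \<Lambda> le"
  and norm_e: "\<kappa> \<in> \<Lambda> \<Longrightarrow> norm (e \<kappa>) \<le> M"
  and e_tendsto: "((\<lambda>\<kappa>. e \<kappa> * a) \<longlongrightarrow> a) net"
  using lai by (auto simp: left_approximate_identity_def)

lemma rM: "r * (M + 1) < 1" "r < 1"
proof -
  show rM: "r * (M + 1) < 1"
    using r_less M by (simp add: field_simps)
  have "r * 1 \<le> r * (M + 1)"
    using M r_pos by (intro mult_left_mono) auto
  then show "r < 1"
    using rM by simp
qed

lemma L_ge: "2 \<le> L"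
  using rM r_pos M unfolding L_def by (simp add: field_simps)

lemma K_ge: "1 \<le> K"
  by (simp add: K_def)

sublocale pi: bounded_linear \<pi>
  by (rule rep.bounded_linear_rep)

sublocale incl: bounded_linear \<iota>
proof (rule bounded_linear_intro[where K = 1])
  show "\<iota> (t *\<^sub>R x) = t *\<^sub>R \<iota> x" for t x
    using sup.incl_scale[of "of_real t" x] by (simp add: sup.A.scale_of_real rep.A.scale_of_real)
qed (simp_all add: sup.incl_add sup.norm_incl)

lemma pi_mult: "\<pi> (a * b) s = \<pi> a (\<pi> b s)"
  by (simp add: rep.rep_mult)

lemma pi_one [simp]: "\<pi> 1 s = s"
  by (simp add: rep.rep_one)

lemma norm_pi: "norm (\<pi> z) \<le> K * norm z"
proof -
  have "norm (\<pi> z) \<le> onorm \<pi> * norm z"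
    by (rule onorm[OF pi.bounded_linear_axioms])
  also have "\<dots> \<le> K * norm z"
    by (intro mult_right_mono) (auto simp: K_def)
  finally show ?thesis .
qed

lemma norm_pi_apply: "norm (\<pi> z s) \<le> K * norm z * norm s"
  using norm_blinfun[of "\<pi> z" s] mult_right_mono[OF norm_pi[of z] norm_ge_zero[of s]] by linarith

lemma norm_pi_power: "norm (\<pi> (z ^ n) s) \<le> (K * norm z) ^ n * norm s"
proof (induction n)
  case (Suc n)
  have "norm (\<pi> (z ^ Suc n) s) \<le> K * norm z * norm (\<pi> (z ^ n) s)"
    using norm_pi_apply[of z "\<pi> (z ^ n) s"] by (simp add: pi_mult)
  also have "\<dots> \<le> K * norm z * ((K * norm z) ^ n * norm s)"
    using K_ge Suc by (intro mult_left_mono) auto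
  finally show ?case
    by (simp add: mult.assoc)
qed simp

lemma eventually_net: "eventually P net \<longleftrightarrow> (\<exists>\<kappa>\<in>\<Lambda>. \<forall>\<mu>\<in>\<Lambda>. le \<kappa> \<mu> \<longrightarrow> P \<mu>)"
  by (rule eventually_net_filter[OF directed])

lemma eventually_in: "eventually (\<lambda>\<kappa>. \<kappa> \<in> \<Lambda>) net"
  using directed by (auto simp: eventually_net directed_set_def)

lemma eventually_witness:
  assumes "eventually P net"
  obtains \<mu> where "\<mu> \<in> \<Lambda>" "P \<mu>"
  using assms directed unfolding eventually_net directed_set_def by (meson reflp_onD)

text \<open>Without a largest element, \<open>le m l\<close> fails for some \<open>m\<close>.
  Whatever lies above a common upper bound of \<open>l\<close> and \<open>m\<close> lies above
  \<open>m\<close> and hence differs from \<open>l\<close>.\<close>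

lemma eventually_next:
  assumes "l \<in> \<Lambda>"
  shows "eventually (\<lambda>\<kappa>. le l \<kappa> \<and> ((\<nexists>m. m \<in> \<Lambda> \<and> (\<forall>\<kappa>\<in>\<Lambda>. le \<kappa> m)) \<longrightarrow> l \<noteq> \<kappa>)) net"
proof (cases "\<exists>m. m \<in> \<Lambda> \<and> (\<forall>\<kappa>\<in>\<Lambda>. le \<kappa> m)")
  case True
  then show ?thesis
    using assms unfolding eventually_net by blast
next
  case False
  then obtain m where m: "m \<in> \<Lambda>" "\<not> le m l"
    using assms by blast
  obtain \<nu> where \<nu>: "\<nu> \<in> \<Lambda>" "le l \<nu>" "le m \<nu>"
    using directed assms m(1) unfolding directed_set_def by blast
  have "le l \<mu> \<and> l \<noteq> \<mu>" if "\<mu> \<in> \<Lambda>" "le \<nu> \<mu>" for \<mu>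
    using directed assms m \<nu> that unfolding directed_set_def by (meson transp_onD)
  then show ?thesis
    using \<nu>(1) unfolding eventually_net by blast
qed

definition algebra_generated :: "'a set \<Rightarrow> 'b set"
  where "algebra_generated U = unital_banach_subalgebra scaleB hull (\<iota> ` U)"

lemma algebra_generated: "unital_banach_subalgebra scaleB (algebra_generated U)"
  unfolding algebra_generated_def
  by (rule unital_banach_subalgebra_hull[OF rep.A.normed_algebra_over_axioms])

lemma algebra_generated_mono: "U \<subseteq> V \<Longrightarrow> algebra_generated U \<subseteq> algebra_generated V"
  unfolding algebra_generated_def by (intro hull_mono image_mono)

lemma algebra_generated_minimal:
  "unital_banach_subalgebra scaleB C \<Longrightarrow> \<iota> ` U \<subseteq> C \<Longrightarrow> algebra_generated U \<subseteq> C"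
  unfolding algebra_generated_def by (rule hull_minimal)

text \<open>Products of elements \<open>c 1 + \<iota> a\<close> have the same form. By minimality
  every generated subalgebra lies in this closure, so its elements are approximated by a scalar plus
  an element of the algebra.\<close>

lemma unital_banach_subalgebra_unitization:
  "unital_banach_subalgebra scaleB (closure {scaleB c 1 + \<iota> a | c a. True})"
proof (rule unital_banach_subalgebra_closure[OF rep.A.normed_algebra_over_axioms])
  let ?C = "{scaleB c 1 + \<iota> a | c a. True}"
  have "\<exists>c a. 0 = scaleB c 1 + \<iota> a"
    by (intro exI[of _ 0]) (simp add: incl.zero)
  moreover have "\<exists>c a. scaleB c1 1 + \<iota> a1 + (scaleB c2 1 + \<iota> a2) = scaleB c 1 + \<iota> a" for c1 a1 c2 a2
    by (intro exI[of _ "c1 + c2"] exI[of _ "a1 + a2"])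
      (simp add: incl.add rep.A.scale_left_distrib)
  moreover have "\<exists>c a. scaleB d (scaleB c1 1 + \<iota> a1) = scaleB c 1 + \<iota> a" for c1 a1 d
    by (intro exI[of _ "d * c1"] exI[of _ "scaleA d a1"])
      (simp add: sup.incl_scale rep.A.scale_right_distrib)
  ultimately show "rep.A.subspace ?C"
    unfolding rep.A.subspace_def by blast
  show "x * y \<in> ?C" if xy: "x \<in> ?C" "y \<in> ?C" for x y
  proof -
    obtain c a d b where "x = scaleB c 1 + \<iota> a" "y = scaleB d 1 + \<iota> b"
      using xy by blast
    then have "x * y = scaleB (c * d) 1 + \<iota> (scaleA c b + scaleA d a + a * b)"
      by (simp add: algebra_simps rep.A.scale_mult_left rep.A.scale_mult_right incl.add
          sup.incl_scale sup.incl_mult)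
    then show ?thesis
      by blast
  qed
  have "1 = scaleB 1 1 + \<iota> 0"
    by (simp add: incl.zero)
  then show "1 \<in> ?C"
    by blast
qed

text \<open>By minimality, whatever commutes with the generators commutes with all of the closed
  subalgebra they generate, in particular with the inverses of the construction.\<close>

lemma unital_banach_subalgebra_centralizer:
  "unital_banach_subalgebra scaleB {z. w * z = z * w}"
  unfolding unital_banach_subalgebra_def rep.A.subspace_def
proof (intro conjI ballI allI)
  show "closed {z. w * z = z * w}"
    by (intro closed_Collect_eq continuous_intros)
  show "x * y \<in> {z. w * z = z * w}" if "x \<in> {z. w * z = z * w}" "y \<in> {z. w * z = z * w}" for x y
    using that by (simp add: mult.assoc) (metis mult.assoc)
qed (simp_all add: rep.A.scale_mult_left rep.A.scale_mult_right distrib_left distrib_right)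

text \<open>Replace \<open>z\<close> by a nearby \<open>c 1 + \<iota> a\<close>. The scalar part
  converges by uniformity on \<open>S\<close>, the other because \<open>e \<kappa> * a\<close> tends
  to \<open>a\<close> in norm. The bound \<open>R\<close> on \<open>S\<close> makes the replacement
  error and the second convergence uniform.\<close>

lemma uniform_limit_bounded_case:
  assumes "bounded S" "z \<in> algebra_generated U"
  shows "uniform_limit S (\<lambda>\<kappa> s. \<pi> (\<iota> (e \<kappa>)) (\<pi> z s)) (\<lambda>s. \<pi> z s) net"
proof (rule uniform_limitI)
  fix \<eta> :: real assume "\<eta> > 0"
  obtain R where R: "R > 0" "\<And>s. s \<in> S \<Longrightarrow> norm s \<le> R"
    using assms(1) bounded_pos by blast
  \<comment> \<open>Each of three errors is allotted \<open>\<eta> / 3\<close>; here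
    \<open>M + 1\<close> bounds the norm of \<open>\<iota> (e \<kappa>) - 1\<close>.\<close>
  define \<theta> where "\<theta> = \<eta> / (3 * K * (M + 1) * R)"
  have "\<theta> > 0"
    using \<open>\<eta> > 0\<close> R K_ge M by (simp add: \<theta>_def)
  have "\<iota> x \<in> {scaleB c 1 + \<iota> a | c a. True}" for x
    by (intro CollectI exI[of _ 0] exI[of _ x]) simp
  then have "\<iota> ` U \<subseteq> closure {scaleB c 1 + \<iota> a | c a. True}"
    using closure_subset by blast
  then have "z \<in> closure {scaleB c 1 + \<iota> a | c a. True}"
    using algebra_generated_minimal[OF unital_banach_subalgebra_unitization] assms(2) by blast
  then obtain z' where z': "z' \<in> {scaleB c 1 + \<iota> a | c a. True}" "dist z' z < \<theta>"
    unfolding closure_approachable using \<open>\<theta> > 0\<close> by blast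
  then obtain c a where ca: "z' = scaleB c 1 + \<iota> a"
    by blast
  have pi_z': "\<pi> z' s = scaleX c s + \<pi> (\<iota> a) s" for s
    unfolding ca by (simp add: pi.add blinfun.add_left rep.rep_scale)
  define \<theta>1 where "\<theta>1 = \<eta> / (3 * (norm c + 1))"
  define \<theta>2 where "\<theta>2 = \<eta> / (3 * K * R)"
  have pos: "\<theta>1 > 0" "\<theta>2 > 0"
    using \<open>\<eta> > 0\<close> R K_ge by (simp_all add: \<theta>1_def \<theta>2_def add_nonneg_pos)
  have "\<forall>\<^sub>F \<kappa> in net. \<forall>s\<in>S. dist (\<pi> (\<iota> (e \<kappa>)) s) s < \<theta>1"
    by (rule uniform_limitD[OF unif pos(1)])
  moreover have "\<forall>\<^sub>F \<kappa> in net. dist (e \<kappa> * a) a < \<theta>2"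
    by (rule tendstoD[OF e_tendsto pos(2)])
  ultimately show "\<forall>\<^sub>F \<kappa> in net. \<forall>s\<in>S. dist (\<pi> (\<iota> (e \<kappa>)) (\<pi> z s)) (\<pi> z s) < \<eta>"
    using eventually_in
  proof eventually_elim
    case (elim \<kappa>)
    show ?case
    proof
      fix s assume s: "s \<in> S"
      let ?u = "\<iota> (e \<kappa>)"
      have decomposition: "\<pi> ?u (\<pi> z s) - \<pi> z s =
        \<pi> ((?u - 1) * (z - z')) s + scaleX c (\<pi> ?u s - s) + \<pi> (\<iota> (e \<kappa> * a - a)) s"
        by (simp add: pi_mult pi.diff blinfun.diff_left blinfun.diff_right pi_z' blinfun.add_right
            rep.operator_scale incl.diff sup.incl_mult rep.X.scale_right_diff_distrib)
      have "norm ((?u - 1) * (z - z')) \<le> (M + 1) * \<theta>"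
      proof (rule order_trans[OF norm_mult_ineq mult_mono])
        show "norm (?u - 1) \<le> M + 1"
          using norm_triangle_ineq4[of ?u 1] norm_e[OF elim(3)] by (simp add: sup.norm_incl)
        show "norm (z - z') \<le> \<theta>"
          using z'(2) by (simp add: dist_norm norm_minus_commute)
      qed (use M in auto)
      then have "K * norm ((?u - 1) * (z - z')) * norm s \<le> K * ((M + 1) * \<theta>) * R"
        using K_ge M R(1) R(2)[OF s] \<open>\<theta> > 0\<close> by (intro mult_mono) auto
      also have "\<dots> = \<eta> / 3"
      proof -
        have "K \<noteq> 0" "M + 1 \<noteq> 0" "R \<noteq> 0"
          using K_ge M R(1) by auto
        then show ?thesis
          by (simp add: \<theta>_def)
      qed
      finally have 1: "norm (\<pi> ((?u - 1) * (z - z')) s) \<le> \<eta> / 3"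
        using norm_pi_apply order_trans by blast
      have "norm c * norm (\<pi> ?u s - s) \<le> norm c * \<theta>1"
        using elim(1) s by (intro mult_left_mono) (auto simp: dist_norm less_imp_le)
      also have "\<dots> \<le> (norm c + 1) * \<theta>1"
        using pos by (intro mult_right_mono) auto
      also have "\<dots> = \<eta> / 3"
        by (simp add: \<theta>1_def field_simps add_nonneg_eq_0_iff)
      finally have 2: "norm (scaleX c (\<pi> ?u s - s)) \<le> \<eta> / 3"
        by (simp add: rep.X.norm_scale)
      have "K * norm (\<iota> (e \<kappa> * a - a)) * norm s \<le> K * norm (\<iota> (e \<kappa> * a - a)) * R"
        using K_ge R(2)[OF s] by (intro mult_left_mono) auto
      also have "\<dots> < K * \<theta>2 * R"
        using elim(2) K_ge R(1) by (simp add: sup.norm_incl dist_norm)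
      also have "\<dots> = \<eta> / 3"
        using K_ge R(1) by (simp add: \<theta>2_def field_simps)
      finally have 3: "norm (\<pi> (\<iota> (e \<kappa> * a - a)) s) < \<eta> / 3"
        using norm_pi_apply order_le_less_trans by blast
      show "dist (\<pi> ?u (\<pi> z s)) (\<pi> z s) < \<eta>"
        unfolding dist_norm decomposition using 1 2 3 by norm
    qed
  qed
qed

text \<open>Commuting gives
  \<open>\<pi> u (\<pi> z s) - \<pi> z s = \<pi> z (\<pi> u s - s)\<close>, so uniform convergence
  on \<open>S\<close> is inherited at the cost of a factor \<open>K * norm z\<close>.\<close>

lemma uniform_limit_commutative_case:
  assumes "commutative_net \<Lambda> e" "U \<subseteq> e ` \<Lambda>" "z \<in> algebra_generated U"
  shows "uniform_limit S (\<lambda>\<kappa> s. \<pi> (\<iota> (e \<kappa>)) (\<pi> z s)) (\<lambda>s. \<pi> z s) net"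
proof (rule uniform_limitI)
  fix \<eta> :: real assume "\<eta> > 0"
  then have "\<eta> / (K * (norm z + 1)) > 0"
    using K_ge by (simp add: add_nonneg_pos)
  from uniform_limitD[OF unif this] eventually_in
  show "\<forall>\<^sub>F \<kappa> in net. \<forall>s\<in>S. dist (\<pi> (\<iota> (e \<kappa>)) (\<pi> z s)) (\<pi> z s) < \<eta>"
  proof eventually_elim
    case (elim \<kappa>)
    show ?case
    proof
      fix s assume s: "s \<in> S"
      let ?u = "\<iota> (e \<kappa>)"
      have "\<iota> ` U \<subseteq> {z. ?u * z = z * ?u}"
        using assms(1,2) elim(2) by (auto simp: commutative_net_def simp flip: sup.incl_mult)
      then have "?u * z = z * ?u"
        using assms(3) algebra_generated_minimal[OF unital_banach_subalgebra_centralizer] by blast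
      then have "\<pi> ?u (\<pi> z s) - \<pi> z s = \<pi> z (\<pi> ?u s - s)"
        by (metis pi_mult blinfun.diff_right)
      then have "dist (\<pi> ?u (\<pi> z s)) (\<pi> z s) \<le> K * norm z * norm (\<pi> ?u s - s)"
        using norm_pi_apply by (simp add: dist_norm)
      also have "\<dots> \<le> K * (norm z + 1) * norm (\<pi> ?u s - s)"
        using K_ge by (intro mult_mono) auto
      also have "\<dots> < K * (norm z + 1) * (\<eta> / (K * (norm z + 1)))"
        using elim(1) s K_ge by (intro mult_strict_left_mono) (auto simp: dist_norm add_nonneg_pos)
      also have "\<dots> = \<eta>"
        using K_ge by (simp add: add_nonneg_eq_0_iff)
      finally show "dist (\<pi> ?u (\<pi> z s)) (\<pi> z s) < \<eta>" .
    qed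
  qed
qed

lemma uniform_limit_generated:
  assumes "U \<subseteq> e ` \<Lambda>" "z \<in> algebra_generated U"
  shows "uniform_limit S (\<lambda>\<kappa> s. \<pi> (\<iota> (e \<kappa>)) (\<pi> z s)) (\<lambda>s. \<pi> z s) net"
  using bounded_or_commutative uniform_limit_bounded_case uniform_limit_commutative_case assms by blast

text \<open>The index \<open>\<kappa>\<close> is chosen before a new inverse is known, so the
  estimate covers every left inverse \<open>y'\<close> of norm at most \<open>Z\<close>. In the
  induction, each further power adds one condition: \<open>\<pi> u\<close> must nearly fix
  \<open>\<pi> (y ^ Suc n) s\<close>.\<close>

lemma eventually_powers_close:
  assumes U: "U \<subseteq> e ` \<Lambda>" "y \<in> algebra_generated U" and "b * y = 1" and "0 < \<eta>"
  shows "\<forall>\<^sub>F \<kappa> in net. \<forall>y'. y' * (b + d *\<^sub>R (\<iota> (e \<kappa>) - 1)) = 1 \<and> norm y' \<le> Z \<longrightarrow>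
    (\<forall>s\<in>S. norm (\<pi> (y' ^ n) s - \<pi> (y ^ n) s) < \<eta>)"
  using \<open>0 < \<eta>\<close>
proof (induction n arbitrary: \<eta>)
  case (Suc n)
  \<comment> \<open>Dominates both \<open>K * norm y'\<close> and
    \<open>\<bar>d\<bar> * K * norm y'\<close>, the factors of the two terms into which the
    difference of powers splits.\<close>
  define W where "W = K * (\<bar>Z\<bar> + 1) * (\<bar>d\<bar> + 1)"
  have "W > 0"
    using K_ge by (simp add: W_def add_nonneg_pos)
  then have "\<eta> / (2 * W) > 0"
    using Suc.prems by simp
  have "y ^ Suc n \<in> algebra_generated U"
    by (rule unital_banach_subalgebra_power[OF algebra_generated U(2)])
  from uniform_limitD[OF uniform_limit_generated[OF U(1) this] \<open>\<eta> / (2 * W) > 0\<close>]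
    Suc.IH[OF \<open>\<eta> / (2 * W) > 0\<close>]
  show ?case
  proof eventually_elim
    case (elim \<kappa>)
    show ?case
    proof (intro allI impI ballI)
      fix y' s
      assume "y' * (b + d *\<^sub>R (\<iota> (e \<kappa>) - 1)) = 1 \<and> norm y' \<le> Z" and s: "s \<in> S"
      then have y': "y' * (b + d *\<^sub>R (\<iota> (e \<kappa>) - 1)) = 1" "norm y' \<le> Z"
        by auto
      let ?u = "\<iota> (e \<kappa>)"
      let ?v = "\<pi> (y' ^ n) s - \<pi> (y ^ n) s" and ?w = "\<pi> ?u (\<pi> (y ^ Suc n) s) - \<pi> (y ^ Suc n) s"
      have v: "norm ?v < \<eta> / (2 * W)"
        using elim(2) y' s by blast
      have w: "norm ?w < \<eta> / (2 * W)"
        using elim(1) s by (simp add: dist_norm)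
      \<comment> \<open>By the resolvent identity, \<open>(y' - y) * y ^ n\<close> becomes a term in
        which \<open>u - 1\<close> acts on \<open>y ^ Suc n\<close>.\<close>
      have "y' ^ Suc n - y ^ Suc n = y' * (y' ^ n - y ^ n) + (- d) *\<^sub>R (y' * (?u * y ^ Suc n - y ^ Suc n))"
        unfolding power_Suc_diff inverse_perturbation[OF \<open>b * y = 1\<close> y'(1)] by (simp add: algebra_simps)
      from arg_cong[OF this, of "\<lambda>z. \<pi> z s"]
      have split: "\<pi> (y' ^ Suc n) s - \<pi> (y ^ Suc n) s = \<pi> y' ?v + (- d) *\<^sub>R \<pi> y' ?w"
        by (simp add: pi.add pi.diff pi.scaleR pi.neg pi_mult blinfun.bilinear_simps del: power_Suc)
      have "norm (\<pi> y' ?v) \<le> K * norm y' * norm ?v"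
        by (rule norm_pi_apply)
      also have "\<dots> = K * norm y' * 1 * norm ?v"
        by simp
      also have "\<dots> \<le> W * norm ?v"
        unfolding W_def using K_ge y'(2) by (intro mult_right_mono mult_mono) auto
      also have "\<dots> < W * (\<eta> / (2 * W))"
        using v \<open>W > 0\<close> by (rule mult_strict_left_mono)
      finally have 1: "norm (\<pi> y' ?v) < \<eta> / 2"
        using \<open>W > 0\<close> by simp
      have "norm ((- d) *\<^sub>R \<pi> y' ?w) \<le> \<bar>d\<bar> * (K * norm y' * norm ?w)"
        using norm_pi_apply[of y' ?w] by (simp add: mult_left_mono)
      also have "\<dots> = K * norm y' * \<bar>d\<bar> * norm ?w"
        by simp
      also have "\<dots> \<le> W * norm ?w"
        unfolding W_def using K_ge y'(2) by (intro mult_right_mono mult_mono) auto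
      also have "\<dots> < W * (\<eta> / (2 * W))"
        using w \<open>W > 0\<close> by (rule mult_strict_left_mono)
      finally have 2: "norm ((- d) *\<^sub>R \<pi> y' ?w) < \<eta> / 2"
        using \<open>W > 0\<close> by simp
      show "norm (\<pi> (y' ^ Suc n) s - \<pi> (y ^ Suc n) s) < \<eta>"
        unfolding split using 1 2 by (intro norm_triangle_lt) linarith
    qed
  qed
qed simp

text \<open>Every requirement on the new index holds eventually along the net. As \<open>F\<close>
  is finite there are finitely many, so a single \<open>\<kappa>\<close> meets them all.\<close>

lemma next_element:
  assumes l: "l \<in> \<Lambda>" and U: "U \<subseteq> e ` \<Lambda>"
    and mem: "b \<in> algebra_generated U" "y \<in> algebra_generated U"
    and b: "b = t *\<^sub>R 1 + \<iota> g" and inv: "b * y = 1" "y * b = 1"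
    and F: "finite F" "\<And>n. n \<in> F \<Longrightarrow> 0 < \<eta> n"
  obtains \<kappa> y' where "\<kappa> \<in> \<Lambda>" "le l \<kappa>" "(\<nexists>m. m \<in> \<Lambda> \<and> (\<forall>\<kappa>\<in>\<Lambda>. le \<kappa> m)) \<longrightarrow> l \<noteq> \<kappa>"
    "y' \<in> algebra_generated (insert (e \<kappa>) U)"
    "(b + (r * t) *\<^sub>R (\<iota> (e \<kappa>) - 1)) * y' = 1" "y' * (b + (r * t) *\<^sub>R (\<iota> (e \<kappa>) - 1)) = 1"
    "norm y' \<le> L * norm y"
    "\<And>n s. n \<in> F \<Longrightarrow> s \<in> S \<Longrightarrow> norm (\<pi> (y' ^ n) s - \<pi> (y ^ n) s) < \<eta> n"
proof -
  \<comment> \<open>Makes \<open>(norm y + 1) * (r / (1 - r * (M + 1)) * \<theta>)\<close> equal to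
    \<open>1 / 2\<close>, the smallness that \<open>perturbed_inverse\<close> asks for; the
    \<open>+ 1\<close> keeps the denominator positive.\<close>
  define \<theta> where "\<theta> = (1 - r * (M + 1)) / (2 * r * (norm y + 1))"
  have "\<theta> > 0"
    using rM r_pos by (simp add: \<theta>_def add_nonneg_pos)
  have "\<forall>\<^sub>F \<kappa> in net. \<forall>n\<in>F. \<forall>y'. y' * (b + (r * t) *\<^sub>R (\<iota> (e \<kappa>) - 1)) = 1 \<and> norm y' \<le> L * norm y \<longrightarrow>
    (\<forall>s\<in>S. norm (\<pi> (y' ^ n) s - \<pi> (y ^ n) s) < \<eta> n)"
    using F by (intro eventually_ball_finite ballI eventually_powers_close[OF U mem(2) inv(1)]) auto
  then have "\<forall>\<^sub>F \<kappa> in net. dist (e \<kappa> * g) g < \<theta> \<and>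
    (le l \<kappa> \<and> ((\<nexists>m. m \<in> \<Lambda> \<and> (\<forall>\<kappa>\<in>\<Lambda>. le \<kappa> m)) \<longrightarrow> l \<noteq> \<kappa>)) \<and>
    (\<forall>n\<in>F. \<forall>y'. y' * (b + (r * t) *\<^sub>R (\<iota> (e \<kappa>) - 1)) = 1 \<and> norm y' \<le> L * norm y \<longrightarrow>
      (\<forall>s\<in>S. norm (\<pi> (y' ^ n) s - \<pi> (y ^ n) s) < \<eta> n))"
    by (intro eventually_conj tendstoD[OF e_tendsto \<open>\<theta> > 0\<close>] eventually_next l)
  then obtain \<kappa> where \<kappa>: "\<kappa> \<in> \<Lambda>" and small: "dist (e \<kappa> * g) g < \<theta>"
    and nxt: "le l \<kappa>" "(\<nexists>m. m \<in> \<Lambda> \<and> (\<forall>\<kappa>\<in>\<Lambda>. le \<kappa> m)) \<longrightarrow> l \<noteq> \<kappa>"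
    and close: "\<And>n y' s. n \<in> F \<Longrightarrow> y' * (b + (r * t) *\<^sub>R (\<iota> (e \<kappa>) - 1)) = 1 \<Longrightarrow>
      norm y' \<le> L * norm y \<Longrightarrow> s \<in> S \<Longrightarrow> norm (\<pi> (y' ^ n) s - \<pi> (y ^ n) s) < \<eta> n"
    by (rule eventually_witness) blast
  let ?u = "\<iota> (e \<kappa>)" and ?C = "algebra_generated (insert (e \<kappa>) U)"
  have "\<exists>y'\<in>?C. (b + (r * t) *\<^sub>R (?u - 1)) * y' = 1 \<and> y' * (b + (r * t) *\<^sub>R (?u - 1)) = 1 \<and>
    norm y' \<le> 2 / (1 - r * (M + 1)) * norm y"
  proof (rule perturbed_inverse[OF rep.A.normed_algebra_over_axioms algebra_generated _ _ _ b inv])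
    show "?u \<in> ?C"
      unfolding algebra_generated_def by (rule hull_inc) simp
    show "b \<in> ?C" "y \<in> ?C"
      using mem algebra_generated_mono[of U "insert (e \<kappa>) U"] by auto
    show "0 \<le> r" "r * (M + 1) < 1"
      using r_pos rM by auto
    have "norm (1 - ?u) \<le> M + 1"
      using norm_triangle_ineq4[of 1 ?u] norm_e[OF \<kappa>] by (simp add: sup.norm_incl)
    then show "norm (r *\<^sub>R (1 - ?u)) \<le> r * (M + 1)"
      using r_pos by simp
    have "(1 - ?u) * \<iota> g = \<iota> (g - e \<kappa> * g)"
      by (simp add: algebra_simps incl.diff sup.incl_mult)
    then have "norm ((1 - ?u) * \<iota> g) \<le> \<theta>"
      using small by (simp add: sup.norm_incl dist_norm norm_minus_commute)
    then have "norm y * (r / (1 - r * (M + 1)) * norm ((1 - ?u) * \<iota> g)) \<le>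
      (norm y + 1) * (r / (1 - r * (M + 1)) * \<theta>)"
      using r_pos rM by (intro mult_mono mult_nonneg_nonneg) auto
    also have "\<dots> = (norm y + 1) / (2 * (norm y + 1))"
      using r_pos rM by (simp add: \<theta>_def)
    also have "\<dots> = 1 / 2"
    proof -
      have "norm y + 1 \<noteq> 0"
        using norm_ge_zero[of y] by linarith
      then show ?thesis
        by simp
    qed
    finally show "norm y * (r / (1 - r * (M + 1)) * norm ((1 - ?u) * \<iota> g)) \<le> 1 / 2" .
  qed
  then show ?thesis
    using that \<kappa> nxt close unfolding L_def by blast
qed

text \<open>Dependent choice over states \<open>(l, b, y, U)\<close>, where \<open>U\<close> records
  the net elements used so far; \<open>next_element\<close> supplies the step.\<close>

lemma factorization_sequence:
  fixes F :: "nat \<Rightarrow> nat set" and \<eta> :: "nat \<Rightarrow> nat \<Rightarrow> real"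
  assumes F: "\<And>k. finite (F k)" "\<And>k n. n \<in> F k \<Longrightarrow> 0 < \<eta> k n"
  obtains l :: "nat \<Rightarrow> 'i" and b y :: "nat \<Rightarrow> 'b"
  where "\<And>k. l k \<in> \<Lambda>" "\<And>k. le (l k) (l (Suc k))"
    "\<And>k. \<nexists>m. m \<in> \<Lambda> \<and> (\<forall>\<kappa>\<in>\<Lambda>. le \<kappa> m) \<Longrightarrow> l k \<noteq> l (Suc k)"
    "\<And>k. b k = (1 - r) ^ k *\<^sub>R 1 + (\<Sum>i=1..k. (r * (1 - r) ^ (i - 1)) *\<^sub>R \<iota> (e (l i)))"
    "\<And>k. y k \<in> algebra_generated ((\<lambda>i. e (l i)) ` {1..k})"
    "\<And>k. b k * y k = 1" "\<And>k. y k * b k = 1" "y 0 = 1" "\<And>k. norm (y k) \<le> L ^ k"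
    "\<And>k n s. n \<in> F k \<Longrightarrow> s \<in> S \<Longrightarrow> norm (\<pi> (y (Suc k) ^ n) s - \<pi> (y k ^ n) s) < \<eta> k n"
proof -
  \<comment> \<open>The witness \<open>g\<close> keeps the scalar part of \<open>b\<close> at
    \<open>(1 - r) ^ k\<close>, the \<open>t\<close> of \<open>next_element\<close>. The clause for
    \<open>k = 0\<close> fixes the initial state.\<close>
  define P where "P k = (\<lambda>(l, b, y, U). l \<in> \<Lambda> \<and> U \<subseteq> e ` \<Lambda> \<and> b \<in> algebra_generated U \<and>
    y \<in> algebra_generated U \<and> b * y = 1 \<and> y * b = 1 \<and> norm y \<le> L ^ k \<and>
    (\<exists>g. b = (1 - r) ^ k *\<^sub>R 1 + \<iota> g) \<and> (k = 0 \<longrightarrow> b = 1 \<and> y = 1 \<and> U = {}))" for k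
  define Q where "Q k = (\<lambda>(l, b, y, U) (l', b', y', U'). le l l' \<and>
    ((\<nexists>m. m \<in> \<Lambda> \<and> (\<forall>\<kappa>\<in>\<Lambda>. le \<kappa> m)) \<longrightarrow> l \<noteq> l') \<and>
    b' = b + (r * (1 - r) ^ k) *\<^sub>R (\<iota> (e l') - 1) \<and> U' = insert (e l') U \<and>
    (\<forall>n\<in>F k. \<forall>s\<in>S. norm (\<pi> (y' ^ n) s - \<pi> (y ^ n) s) < \<eta> k n))" for k
  have one: "1 \<in> algebra_generated U" for U
    using algebra_generated unfolding unital_banach_subalgebra_def by blast
  have "\<exists>f. \<forall>k. P k (f k) \<and> Q k (f k) (f (Suc k))"
  proof (rule dependent_nat_choice)
    \<comment> \<open>This becomes \<open>l 0\<close>, which only starts the chain: the sum in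
      \<open>b\<close> and the set \<open>U\<close> begin with index \<open>1\<close>.\<close>
    obtain l0 where "l0 \<in> \<Lambda>"
      using directed unfolding directed_set_def by blast
    then have "P 0 (l0, 1, 1, {})"
      using one incl.zero by (auto simp: P_def intro!: exI[of _ 0])
    then show "\<exists>x. P 0 x" ..
  next
    fix x k assume "P k x"
    then obtain l b y U g where x: "x = (l, b, y, U)" and l: "l \<in> \<Lambda>" and U: "U \<subseteq> e ` \<Lambda>"
      and mem: "b \<in> algebra_generated U" "y \<in> algebra_generated U"
      and inv: "b * y = 1" "y * b = 1" and y: "norm y \<le> L ^ k"
      and b: "b = (1 - r) ^ k *\<^sub>R 1 + \<iota> g"
      by (cases x) (auto simp: P_def)
    obtain \<kappa> y' where step: "\<kappa> \<in> \<Lambda>" "le l \<kappa>" "(\<nexists>m. m \<in> \<Lambda> \<and> (\<forall>\<kappa>\<in>\<Lambda>. le \<kappa> m)) \<longrightarrow> l \<noteq> \<kappa>"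
      "y' \<in> algebra_generated (insert (e \<kappa>) U)"
      "(b + (r * (1 - r) ^ k) *\<^sub>R (\<iota> (e \<kappa>) - 1)) * y' = 1"
      "y' * (b + (r * (1 - r) ^ k) *\<^sub>R (\<iota> (e \<kappa>) - 1)) = 1"
      "norm y' \<le> L * norm y"
      "\<And>n s. n \<in> F k \<Longrightarrow> s \<in> S \<Longrightarrow> norm (\<pi> (y' ^ n) s - \<pi> (y ^ n) s) < \<eta> k n"
      using next_element[where F = "F k" and \<eta> = "\<eta> k", OF l U mem b inv F] by metis
    define b' where "b' = b + (r * (1 - r) ^ k) *\<^sub>R (\<iota> (e \<kappa>) - 1)"
    let ?C = "algebra_generated (insert (e \<kappa>) U)"
    have sub: "rep.A.subspace ?C"
      using algebra_generated unfolding unital_banach_subalgebra_def by blast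
    have "\<iota> (e \<kappa>) \<in> ?C"
      unfolding algebra_generated_def by (rule hull_inc) simp
    then have "b' \<in> ?C"
      unfolding b'_def using algebra_generated_mono[of U "insert (e \<kappa>) U"] mem(1) one
      by (intro rep.A.subspace_add[OF sub] rep.A.subspace_scaleR[OF sub] rep.A.subspace_diff[OF sub]) auto
    moreover have "norm y' \<le> L ^ Suc k"
      using order_trans[OF step(7) mult_left_mono[OF y]] L_ge by simp
    \<comment> \<open>The scalar part loses the fraction \<open>r\<close> of itself, and
      \<open>(1 - r) ^ k\<close> becomes \<open>(1 - r) ^ Suc k\<close>.\<close>
    moreover have "b' = (1 - r) ^ Suc k *\<^sub>R 1 + \<iota> (g + (r * (1 - r) ^ k) *\<^sub>R e \<kappa>)"
      by (simp add: b'_def b incl.add incl.scaleR algebra_simps)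
    ultimately have "P (Suc k) (\<kappa>, b', y', insert (e \<kappa>) U)"
      using step U by (auto simp: P_def b'_def[symmetric])
    moreover have "Q k x (\<kappa>, b', y', insert (e \<kappa>) U)"
      using step by (auto simp: Q_def x b'_def)
    ultimately show "\<exists>x'. P (Suc k) x' \<and> Q k x x'"
      by blast
  qed
  then obtain f where f: "\<And>k. P k (f k)" "\<And>k. Q k (f k) (f (Suc k))"
    by blast
  define l b y U where lbyU: "l = (\<lambda>k. fst (f k))" "b = (\<lambda>k. fst (snd (f k)))"
    "y = (\<lambda>k. fst (snd (snd (f k))))" "U = (\<lambda>k. snd (snd (snd (f k))))"
  have "f k = (l k, b k, y k, U k)" for k
    by (simp add: lbyU)
  then have P: "P k (l k, b k, y k, U k)"
    and Q: "Q k (l k, b k, y k, U k) (l (Suc k), b (Suc k), y (Suc k), U (Suc k))" for k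
    using f by metis+
  have U: "U k = (\<lambda>i. e (l i)) ` {1..k}" for k
  proof (induction k)
    case (Suc k)
    then show ?case
      using Q[of k] by (simp add: Q_def atLeastAtMostSuc_conv)
  qed (use P[of 0] in \<open>simp add: P_def\<close>)
  have b: "b k = (1 - r) ^ k *\<^sub>R 1 + (\<Sum>i=1..k. (r * (1 - r) ^ (i - 1)) *\<^sub>R \<iota> (e (l i)))" for k
  proof (induction k)
    case (Suc k)
    have "b (Suc k) = b k + (r * (1 - r) ^ k) *\<^sub>R (\<iota> (e (l (Suc k))) - 1)"
      using Q[of k] by (simp add: Q_def)
    then show ?case
      unfolding Suc by (simp add: algebra_simps)
  qed (use P[of 0] in \<open>simp add: P_def\<close>)
  show ?thesis
    by (rule that[of l b y]) (use P Q b U in \<open>auto simp: P_def Q_def\<close>)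
qed

end

theorem theorem4p4:
  fixes scaleA :: "'f::real_normed_field \<Rightarrow> 'a::{real_normed_algebra, banach} \<Rightarrow> 'a"
    and scaleX :: "'f \<Rightarrow> 'x::banach \<Rightarrow> 'x"
    and scaleB :: "'f \<Rightarrow> 'b::{real_normed_algebra_1, banach} \<Rightarrow> 'b"
    and \<Lambda> :: "'i set" and le :: "'i \<Rightarrow> 'i \<Rightarrow> bool" and e :: "'i \<Rightarrow> 'a" and M :: real
    and \<pi>A :: "'a \<Rightarrow> ('x \<Rightarrow>\<^sub>L 'x)" and \<pi> :: "'b \<Rightarrow> ('x \<Rightarrow>\<^sub>L 'x)" and \<iota> :: "'a \<Rightarrow> 'b"
    and S :: "'x set"
    and \<epsilon> \<delta> r :: real and n\<^sub>0 :: nat and \<alpha> :: "nat \<Rightarrow> real"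
  assumes "normed_algebra_over scaleA"
    and "normed_space_over scaleX"
    and "left_approximate_identity \<Lambda> le e M" and "M \<ge> 1"
    and "continuous_representation scaleA scaleX \<pi>A"
    and "S \<noteq> {}"
    and "uniform_limit S (\<lambda>\<kappa> s. \<pi>A (e \<kappa>) s) (\<lambda>s. s) (net_filter \<Lambda> le)"
    and "bounded S \<or> commutative_net \<Lambda> e"
    and "unital_banach_superalgebra scaleA scaleB \<iota>"
    and "continuous_unital_representation scaleB scaleX \<pi>"
    and "\<And>a. \<pi> (\<iota> a) = \<pi>A a"
    and "\<epsilon> > 0" and "\<delta> > 0" and "0 < r" and "r < 1 / (M + 1)" and "n\<^sub>0 \<ge> 1"
    and "\<And>n. n \<ge> 1 \<Longrightarrow> \<alpha> n > 1" and "filterlim \<alpha> at_top sequentially"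
  shows "\<exists>(a::'a) (x :: nat \<Rightarrow> 'x \<Rightarrow> 'x).
    \<comment> \<open>(1)\<close>
    (\<forall>n\<ge>1. \<forall>s\<in>S. s = \<pi> (\<iota> a ^ n) (x n s)) \<and>
    \<comment> \<open>(2)\<close>
    norm a \<le> M \<and>
    \<comment> \<open>(3)\<close>
    (\<forall>n\<ge>1. uniformly_continuous_on S (x n) \<and>
      homeomorphism S (x n ` S) (x n) (blinfun_apply (\<pi> (\<iota> a ^ n)))) \<and>
    \<comment> \<open>(4)\<close>
    (\<forall>n s. 1 \<le> n \<and> n \<le> n\<^sub>0 \<and> s \<in> S \<longrightarrow> norm (s - x n s) \<le> \<epsilon>) \<and>
    (\<forall>n\<ge>1. \<forall>s\<in>S. norm (x n s) \<le> \<alpha> n ^ n * max (norm s) \<delta>) \<and>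
    \<comment> \<open>(5)\<close>
    (\<forall>s\<^sub>1\<in>S. \<forall>s\<^sub>2\<in>S. s\<^sub>1 + s\<^sub>2 \<in> S \<longrightarrow> (\<forall>n\<ge>1. x n (s\<^sub>1 + s\<^sub>2) = x n s\<^sub>1 + x n s\<^sub>2)) \<and>
    (\<forall>\<mu>. \<forall>s\<in>S. scaleX \<mu> s \<in> S \<longrightarrow> (\<forall>n\<ge>1. x n (scaleX \<mu> s) = scaleX \<mu> (x n s))) \<and>
    \<comment> \<open>(6)\<close>
    (\<exists>u :: nat \<Rightarrow> 'a. (\<forall>i\<ge>1. u i \<in> e ` \<Lambda>) \<and>
      ((\<lambda>i. (r * (1 - r) ^ i) *\<^sub>R u (Suc i)) sums a) \<and>
      a \<in> closure (convex hull (u ` {1..})) \<and>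
      (\<exists>b :: nat \<Rightarrow> 'b.
        (\<forall>k. b k = (1 - r) ^ k *\<^sub>R 1 + (\<Sum>i=1..k. (r * (1 - r) ^ (i - 1)) *\<^sub>R \<iota> (u i)) \<and>
          b k \<in> convex hull (insert 1 ((\<lambda>i. \<iota> (u i)) ` {1..k})) \<and>
          invertible_element (b k) \<and>
          inverse_element (b k) \<in>
            unital_banach_subalgebra scaleB hull ((\<lambda>i. \<iota> (u i)) ` {1..k})) \<and>
        (\<forall>n\<ge>1. \<forall>s\<in>S. (\<lambda>k. \<pi> (inverse_element (b k) ^ n) s) \<longlonglongrightarrow> x n s)) \<and>
      (\<exists>l :: nat \<Rightarrow> 'i. (\<forall>k\<ge>1. l k \<in> \<Lambda> \<and> le (l k) (l (Suc k)) \<and> u k = e (l k)) \<and>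
        ((\<nexists>m. m \<in> \<Lambda> \<and> (\<forall>\<kappa>\<in>\<Lambda>. le \<kappa> m)) \<longrightarrow> (\<forall>k\<ge>1. l k \<noteq> l (Suc k))))) \<and>
    \<comment> \<open>(7)\<close>
    (bounded S \<longrightarrow> (\<forall>n\<ge>1. bounded (x n ` S))) \<and>
    (totally_bounded S \<longrightarrow> (\<forall>n\<ge>1. totally_bounded (x n ` S))) \<and>
    (\<forall>n\<ge>1. uniform_limit S (\<lambda>\<kappa> s. \<pi> (\<iota> (e \<kappa>)) (x n s)) (\<lambda>s. x n s) (net_filter \<Lambda> le))"
proof -

  \<comment> \<open>The setting of the construction\<close>
  interpret uniform_factorization scaleA scaleB scaleX \<pi> \<iota> \<Lambda> le e M r S
  proof (intro uniform_factorization.intro uniform_factorization_axioms.intro)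
    show "uniform_limit S (\<lambda>\<kappa> s. \<pi> (\<iota> (e \<kappa>)) s) (\<lambda>s. s) (net_filter \<Lambda> le)"
      using assms(7) by (simp only: assms(11))
    show "continuous_unital_representation scaleB scaleX \<pi>"
      by (rule assms(10))
    show "unital_banach_superalgebra scaleA scaleB \<iota>"
      by (rule assms(9))
  qed (rule assms(3,4,8,14,15))+

  \<comment> \<open>Exponents controlled at each step, and their tolerances\<close>
  define F where "F k = {n. 1 \<le> n \<and> (n \<le> n\<^sub>0 \<or> \<alpha> n < K * L ^ Suc k + 1)}" for k
  \<comment> \<open>\<open>\<epsilon>\<close> serves closeness to the identity. For the growth
    bound, \<open>(\<alpha> n - 1) * \<delta>\<close> serves exponents controlled from step
    \<open>0\<close> and \<open>\<delta>\<close> those controlled later.\<close>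
  define \<eta> where "\<eta> n = min \<epsilon> (min \<delta> ((\<alpha> n - 1) * \<delta>))" for n
  have \<eta>_pos: "0 < \<eta> n" if "1 \<le> n" for n
    using assms(12,13) assms(17)[OF that] by (simp add: \<eta>_def)
  have finite_F: "finite (F k)" for k
  proof -
    have "\<forall>\<^sub>F n in sequentially. K * L ^ Suc k + 1 \<le> \<alpha> n"
      using assms(18) by (simp add: filterlim_at_top)
    then obtain N where "\<And>n. N \<le> n \<Longrightarrow> K * L ^ Suc k + 1 \<le> \<alpha> n"
      unfolding eventually_sequentially by blast
    then have "n \<le> max n\<^sub>0 N" if "n \<in> F k" for n
      using that unfolding F_def mem_Collect_eq by (meson le_max_iff_disj not_le le_cases)
    then have "F k \<subseteq> {..max n\<^sub>0 N}"
      by auto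
    then show ?thesis
      by (rule finite_subset) simp
  qed
  have F_mono: "F j \<subseteq> F k" if "j \<le> k" for j k
  proof -
    have "K * L ^ Suc j \<le> K * L ^ Suc k"
      using that L_ge K_ge by (intro mult_left_mono power_increasing) auto
    then show ?thesis
      unfolding F_def by auto
  qed
  have F_exhausts: "\<exists>k. n \<in> F k" if "1 \<le> n" for n
  proof -
    obtain k where "\<alpha> n < L ^ k"
      using real_arch_pow[of L "\<alpha> n"] L_ge by auto
    also have "L ^ k \<le> 1 * L ^ Suc k"
      using L_ge by (simp add: mult_le_cancel_right1)
    also have "\<dots> \<le> K * L ^ Suc k"
      using K_ge L_ge by (intro mult_right_mono) auto
    finally have "n \<in> F k"
      using that by (simp add: F_def)
    then show ?thesis ..
  qed
  have F_pos: "0 < \<eta> n / 2 ^ Suc k" if "n \<in> F k" for n k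
    using \<eta>_pos that by (simp add: F_def)

  \<comment> \<open>The approximating sequence and the limit maps\<close>
  obtain l b y where l: "\<And>k. l k \<in> \<Lambda>" "\<And>k. le (l k) (l (Suc k))"
      "\<And>k. \<nexists>m. m \<in> \<Lambda> \<and> (\<forall>\<kappa>\<in>\<Lambda>. le \<kappa> m) \<Longrightarrow> l k \<noteq> l (Suc k)"
    and b: "\<And>k. b k = (1 - r) ^ k *\<^sub>R 1 + (\<Sum>i=1..k. (r * (1 - r) ^ (i - 1)) *\<^sub>R \<iota> (e (l i)))"
    and y: "\<And>k. y k \<in> algebra_generated ((\<lambda>i. e (l i)) ` {1..k})"
    and inv: "\<And>k. b k * y k = 1" "\<And>k. y k * b k = 1" and y0: "y 0 = 1" and norm_y: "\<And>k. norm (y k) \<le> L ^ k"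
    and close: "\<And>k n s. n \<in> F k \<Longrightarrow> s \<in> S \<Longrightarrow> norm (\<pi> (y (Suc k) ^ n) s - \<pi> (y k ^ n) s) < \<eta> n / 2 ^ Suc k"
    using factorization_sequence[where F = F and \<eta> = "\<lambda>k n. \<eta> n / 2 ^ Suc k", OF finite_F F_pos]
    by blast
  define u where "u k = e (l k)" for k
  define c where "c n k s = \<pi> (y k ^ n) s" for n k s
  define x where "x n s = lim (\<lambda>k. c n k s)" for n s
  \<comment> \<open>The first step at which \<open>n\<close> is controlled; since the sets
    \<open>F k\<close> increase, it stays controlled afterwards.\<close>
  define m where "m n = (LEAST k. n \<in> F k)" for n

  have "n \<in> F (m n)" if "1 \<le> n" for n
    unfolding m_def using F_exhausts[OF that] by (rule LeastI_ex)
  then have F_ge: "n \<in> F k" if "1 \<le> n" "m n \<le> k" for n k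
    using that F_mono by blast
  have increments: "norm (c n (Suc k) s - c n k s) \<le> \<eta> n / 2 ^ Suc k" if "1 \<le> n" "m n \<le> k" "s \<in> S" for n k s
    unfolding c_def using close[OF F_ge[OF that(1,2)] that(3)] by simp
  have x_lim: "(\<lambda>k. c n k s) \<longlonglongrightarrow> x n s" if "1 \<le> n" "s \<in> S" for n s
    unfolding x_def by (rule geometric_increments_tendsto[where m = "m n" and S = S, OF increments[OF that(1)] that(2)])
  have x_near: "norm (x n s - c n (m n) s) \<le> \<eta> n" if "1 \<le> n" "s \<in> S" for n s
  proof -
    have "norm (x n s - c n (m n) s) \<le> \<eta> n / 2 ^ m n"
      unfolding x_def by (rule geometric_increments_le[where S = S, OF increments[OF that(1)] that(2) order_refl])
    also have "\<dots> \<le> \<eta> n"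
      using \<eta>_pos[OF that(1)] by (simp add: divide_le_eq mult_le_cancel_left1)
    finally show ?thesis .
  qed
  have x_unif: "uniform_limit S (c n) (x n) sequentially" if "1 \<le> n" for n
    unfolding x_def[abs_def] by (rule geometric_increments_uniform[where m = "m n"]) (rule increments[OF that])

  \<comment> \<open>The element \<open>a\<close> as an infinite convex combination\<close>
  have weights: "(\<lambda>i. r * (1 - r) ^ i) sums 1"
    using sums_mult[OF geometric_sums[of "1 - r"], of r] r_pos rM by simp
  have weights_pos: "0 < r * (1 - r) ^ i" for i
    using r_pos rM by simp
  have norm_u: "norm ((r * (1 - r) ^ i) *\<^sub>R u (Suc i)) \<le> r * (1 - r) ^ i * M" for i
    unfolding norm_scaleR abs_of_pos[OF weights_pos] u_def
    by (intro mult_left_mono norm_e l(1) less_imp_le[OF weights_pos])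
  have weights_M: "(\<lambda>i. r * (1 - r) ^ i * M) sums M"
    using sums_mult2[OF weights, of M] by simp
  have "summable (\<lambda>i. (r * (1 - r) ^ i) *\<^sub>R u (Suc i))"
    by (rule summable_comparison_test'[OF sums_summable[OF weights_M], of 0]) (rule norm_u)
  then obtain a where a: "(\<lambda>i. (r * (1 - r) ^ i) *\<^sub>R u (Suc i)) sums a"
    unfolding summable_def by blast
  have norm_a: "norm a \<le> M"
    by (rule norm_sums_le[OF a weights_M norm_u])
  have u_image: "u ` {1..} = range (\<lambda>i. u (Suc i))"
    by (force simp: image_iff intro: Suc_pred[symmetric] dest: Suc_le_D)
  have a_hull: "a \<in> closure (convex hull (u ` {1..}))"
    unfolding u_image by (rule sums_in_closure_convex_hull[OF a weights weights_pos])

  \<comment> \<open>Factorization, uniform continuity and homeomorphism\<close>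
  have "b \<longlonglongrightarrow> 0 *\<^sub>R 1 + \<iota> a"
  proof -
    \<comment> \<open>Only the multiple of the unit lies outside the embedded algebra, and its
      coefficient tends to \<open>0\<close>.\<close>
    have "b = (\<lambda>k. (1 - r) ^ k *\<^sub>R 1 + \<iota> (\<Sum>i<k. (r * (1 - r) ^ i) *\<^sub>R u (Suc i)))"
      by (simp add: b fun_eq_iff incl.sum incl.scaleR u_def sum.atLeast1_atMost_eq)
    moreover have null: "(\<lambda>k. (1 - r) ^ k) \<longlonglongrightarrow> 0"
      using r_pos rM by (intro LIMSEQ_power_zero) simp
    ultimately show ?thesis
      by (simp only:) (intro tendsto_add tendsto_scaleR tendsto_const null incl.tendsto a[unfolded sums_def])
  qed
  then have b_lim: "b \<longlonglongrightarrow> \<iota> a"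
    by simp
  have factor: "\<pi> (\<iota> a ^ n) (x n s) = s" if "1 \<le> n" "s \<in> S" for n s
  proof (rule LIMSEQ_unique)
    show "(\<lambda>k. \<pi> (b k ^ n) (c n k s)) \<longlonglongrightarrow> \<pi> (\<iota> a ^ n) (x n s)"
      by (intro blinfun.tendsto pi.tendsto tendsto_power b_lim x_lim that)
    \<comment> \<open>The powers of \<open>b k\<close> and \<open>y k\<close> cancel, so the
      sequence is constant.\<close>
    have "\<pi> (b k ^ n) (c n k s) = s" for k
      using left_right_inverse_power[OF inv(1), of k n] by (simp add: c_def flip: pi_mult)
    then show "(\<lambda>k. \<pi> (b k ^ n) (c n k s)) \<longlonglongrightarrow> s"
      by simp
  qed
  have uc: "uniformly_continuous_on S (x n)" if "1 \<le> n" for n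
  proof (rule uniformly_continuous_on_uniform_limit[OF x_unif[OF that] sequentially_bot])
    show "uniformly_continuous_on S (c n k)" for k
      unfolding c_def
      by (rule bounded_linear.uniformly_continuous_on[OF blinfun.bounded_linear_right uniformly_continuous_on_id])
  qed
  have homeo: "homeomorphism S (x n ` S) (x n) (blinfun_apply (\<pi> (\<iota> a ^ n)))" if "1 \<le> n" for n
    unfolding homeomorphism_def
    using factor[OF that] uniformly_continuous_imp_continuous[OF uc[OF that]]
    by (auto simp: image_image intro!: linear_continuous_on blinfun.bounded_linear_right)

  \<comment> \<open>Closeness to the identity and growth\<close>
  have near_id: "norm (s - x n s) \<le> \<epsilon>" if "1 \<le> n" "n \<le> n\<^sub>0" "s \<in> S" for n s
  proof -
    \<comment> \<open>Exponents up to \<open>n\<^sub>0\<close> are controlled from step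
      \<open>0\<close>, where \<open>y 0 = 1\<close> makes \<open>c n 0\<close> the
      identity.\<close>
    have "n \<in> F 0"
      using that by (simp add: F_def)
    then have "m n = 0"
      unfolding m_def by (rule Least_eq_0)
    then have "norm (x n s - s) \<le> \<eta> n"
      using x_near[OF that(1,3)] by (simp add: c_def y0)
    then show ?thesis
      by (simp add: \<eta>_def norm_minus_commute)
  qed
  have growth: "norm (x n s) \<le> \<alpha> n ^ n * max (norm s) \<delta>" if n: "1 \<le> n" and s: "s \<in> S" for n s
  proof -
    have \<alpha>: "1 < \<alpha> n"
      using assms(17)[OF n] .
    let ?N = "max (norm s) \<delta>"
    have N: "norm s \<le> ?N" "\<delta> \<le> ?N" "0 < ?N"
      using \<open>\<delta> > 0\<close> by auto
    have *: "norm (x n s) \<le> \<eta> n + norm (c n (m n) s)"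
      using norm_triangle_sub[of "x n s" "c n (m n) s"] x_near[OF n s] by linarith
    show ?thesis
    proof (cases "m n")
      case 0
      have "(\<alpha> n - 1) * \<delta> \<le> (\<alpha> n - 1) * ?N"
        using \<alpha> by (intro mult_left_mono) auto
      then have "norm (x n s) \<le> (\<alpha> n - 1) * ?N + ?N"
        using * N(1) by (simp add: 0 c_def y0 \<eta>_def)
      also have "\<dots> = \<alpha> n ^ 1 * ?N"
        by (simp add: algebra_simps)
      also have "\<dots> \<le> \<alpha> n ^ n * ?N"
        using \<alpha> n N(3) by (intro mult_right_mono power_increasing) auto
      finally show ?thesis .
    next
      case (Suc k)
      \<comment> \<open>Not being controlled at step \<open>k\<close> gives
        \<open>K * L ^ Suc k \<le> \<alpha> n - 1\<close>, and \<open>L ^ Suc k\<close> is the norm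
        bound for \<open>y\<close> at the first controlled step \<open>Suc k\<close>.\<close>
      then have "n \<notin> F k"
        unfolding m_def using not_less_Least[of k "\<lambda>k. n \<in> F k"] by simp
      then have "K * L ^ Suc k \<le> \<alpha> n - 1"
        using n by (simp add: F_def)
      then have "K * norm (y (m n)) \<le> \<alpha> n - 1"
        using order_trans[OF mult_left_mono[OF norm_y[of "m n"], of K]] K_ge Suc by simp
      then have "(K * norm (y (m n))) ^ n \<le> (\<alpha> n - 1) ^ n"
        using K_ge by (intro power_mono) auto
      then have "norm (c n (m n) s) \<le> (\<alpha> n - 1) ^ n * norm s"
        unfolding c_def using order_trans[OF norm_pi_power mult_right_mono] by simp
      also have "\<dots> \<le> (\<alpha> n - 1) ^ n * ?N"
        using \<alpha> N by (intro mult_left_mono) auto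
      finally have "norm (x n s) \<le> ((\<alpha> n - 1) ^ n + 1) * ?N"
        using * N(2) by (simp add: \<eta>_def algebra_simps)
      also have "\<dots> \<le> \<alpha> n ^ n * ?N"
        using power_add_one_ge[of "\<alpha> n - 1" n] \<alpha> n N by (intro mult_right_mono) auto
      finally show ?thesis .
    qed
  qed

  \<comment> \<open>Additivity and homogeneity\<close>
  have x_add: "x n (s1 + s2) = x n s1 + x n s2" if "1 \<le> n" "s1 \<in> S" "s2 \<in> S" "s1 + s2 \<in> S" for n s1 s2
  proof (rule LIMSEQ_unique[OF x_lim])
    have "(\<lambda>k. c n k s1 + c n k s2) \<longlonglongrightarrow> x n s1 + x n s2"
      by (intro tendsto_add x_lim that)
    then show "(\<lambda>k. c n k (s1 + s2)) \<longlonglongrightarrow> x n s1 + x n s2"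
      by (simp add: c_def blinfun.add_right)
  qed (use that in auto)
  have x_scale: "x n (scaleX \<mu> s) = scaleX \<mu> (x n s)" if "1 \<le> n" "s \<in> S" "scaleX \<mu> s \<in> S" for n s \<mu>
  proof (rule LIMSEQ_unique[OF x_lim])
    have "(\<lambda>k. scaleX \<mu> (c n k s)) \<longlonglongrightarrow> scaleX \<mu> (x n s)"
      by (intro bounded_linear.tendsto[OF rep.X.bounded_linear_scale] x_lim that)
    then show "(\<lambda>k. c n k (scaleX \<mu> s)) \<longlonglongrightarrow> scaleX \<mu> (x n s)"
      by (simp add: c_def rep.operator_scale)
  qed (use that in auto)

  \<comment> \<open>The convex combinations \<open>b k\<close> and their inverses\<close>
  have b_hull: "b k \<in> convex hull (insert 1 ((\<lambda>i. \<iota> (u i)) ` {1..k}))" for k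
  proof -
    \<comment> \<open>Index \<open>0\<close> stands for the unit and carries the weight left over by
      the truncated geometric series.\<close>
    define w where "w i = (if i = 0 then (1 - r) ^ k else r * (1 - r) ^ (i - 1))" for i
    define v where "v i = (if i = 0 then 1 else \<iota> (u i))" for i
    have "(\<Sum>i\<in>insert 0 {1..k}. w i *\<^sub>R v i) \<in> convex hull (insert 1 ((\<lambda>i. \<iota> (u i)) ` {1..k}))"
    proof (rule convex_sum)
      have "(\<Sum>i=1..k. w i) = r * (\<Sum>i<k. (1 - r) ^ i)"
        by (simp add: w_def sum.atLeast1_atMost_eq sum_distrib_left)
      also have "\<dots> = 1 - (1 - r) ^ k"
        using one_diff_power_eq[of "1 - r" k] by simp
      finally show "(\<Sum>i\<in>insert 0 {1..k}. w i) = 1"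
        by (simp add: w_def)
      show "0 \<le> w i" for i
        using r_pos rM by (simp add: w_def)
      show "v i \<in> convex hull (insert 1 ((\<lambda>i. \<iota> (u i)) ` {1..k}))" if "i \<in> insert 0 {1..k}" for i
        using that by (intro hull_inc) (auto simp: v_def)
    qed (auto simp: convex_convex_hull)
    also have "(\<Sum>i\<in>insert 0 {1..k}. w i *\<^sub>R v i) = b k"
      by (simp add: b w_def v_def u_def)
    finally show ?thesis .
  qed
  have inverse_b: "inverse_element (b k) = y k" for k
    by (rule inverse_element_eq[OF inv])
  have b_properties: "\<forall>k. b k = (1 - r) ^ k *\<^sub>R 1 + (\<Sum>i=1..k. (r * (1 - r) ^ (i - 1)) *\<^sub>R \<iota> (u i)) \<and>
    b k \<in> convex hull (insert 1 ((\<lambda>i. \<iota> (u i)) ` {1..k})) \<and> invertible_element (b k) \<and>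
    inverse_element (b k) \<in> unital_banach_subalgebra scaleB hull ((\<lambda>i. \<iota> (u i)) ` {1..k})"
  proof (intro allI conjI)
    fix k
    show "b k = (1 - r) ^ k *\<^sub>R 1 + (\<Sum>i=1..k. (r * (1 - r) ^ (i - 1)) *\<^sub>R \<iota> (u i))"
      unfolding u_def by (rule b)
    show "invertible_element (b k)"
      using inv unfolding invertible_element_def by blast
    show "inverse_element (b k) \<in> unital_banach_subalgebra scaleB hull ((\<lambda>i. \<iota> (u i)) ` {1..k})"
      using y[of k] by (simp add: inverse_b u_def algebra_generated_def image_image)
  qed (rule b_hull)

  \<comment> \<open>Boundedness and uniform convergence on the images\<close>
  have bounded_image: "bounded (x n ` S)" if "bounded S" "1 \<le> n" for n
  proof -
    obtain R where R: "\<And>s. s \<in> S \<Longrightarrow> norm s \<le> R"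
      using \<open>bounded S\<close> unfolding bounded_iff by blast
    have "norm (x n s) \<le> \<alpha> n ^ n * max R \<delta>" if "s \<in> S" for s
    proof -
      have "\<alpha> n ^ n * max (norm s) \<delta> \<le> \<alpha> n ^ n * max R \<delta>"
        using R[OF that] assms(17)[OF \<open>1 \<le> n\<close>] by (intro mult_left_mono max.mono) auto
      then show ?thesis
        using growth[OF \<open>1 \<le> n\<close> that] by linarith
    qed
    then show ?thesis
      unfolding bounded_iff by blast
  qed
  have unif_image: "uniform_limit S (\<lambda>\<kappa> s. \<pi> (\<iota> (e \<kappa>)) (x n s)) (\<lambda>s. x n s) net" if n: "1 \<le> n" for n
  proof (rule uniform_limitI)
    fix \<theta> :: real assume "\<theta> > 0"
    have KM: "1 \<le> K * M"
      using mult_mono[of 1 K 1 M] K_ge M by simp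
    then have pos: "\<theta> / (3 * (K * M)) > 0" "\<theta> / 3 > 0"
      using \<open>\<theta> > 0\<close> by auto
    \<comment> \<open>One fixed \<open>k\<close> reduces the claim to
      \<open>\<pi> (y k ^ n) s\<close> with \<open>y k ^ n\<close> in a generated subalgebra. The
      tolerance is divided by \<open>K * M\<close>, which bounds the operators
      \<open>\<pi> (\<iota> (e \<kappa>))\<close>.\<close>
    obtain k where k: "\<And>s. s \<in> S \<Longrightarrow> dist (c n k s) (x n s) < \<theta> / (3 * (K * M))"
      using eventually_happens'[OF sequentially_bot uniform_limitD[OF x_unif[OF n] pos(1)]] by blast
    have "uniform_limit S (\<lambda>\<kappa> s. \<pi> (\<iota> (e \<kappa>)) (c n k s)) (\<lambda>s. c n k s) net"
      unfolding c_def
      by (rule uniform_limit_generated[OF _ unital_banach_subalgebra_power[OF algebra_generated y]])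
        (use l(1) in auto)
    from uniform_limitD[OF this pos(2)] eventually_in
    show "\<forall>\<^sub>F \<kappa> in net. \<forall>s\<in>S. dist (\<pi> (\<iota> (e \<kappa>)) (x n s)) (x n s) < \<theta>"
    proof eventually_elim
      case (elim \<kappa>)
      show ?case
      proof
        fix s assume s: "s \<in> S"
        let ?u = "\<pi> (\<iota> (e \<kappa>))"
        have d: "dist (x n s) (c n k s) < \<theta> / (3 * (K * M))"
          using k[OF s] by (simp add: dist_commute)
        have "dist (?u (x n s)) (?u (c n k s)) \<le> K * norm (e \<kappa>) * dist (x n s) (c n k s)"
          using norm_pi_apply[of "\<iota> (e \<kappa>)"] by (simp add: dist_norm sup.norm_incl flip: blinfun.diff_right)
        also have "\<dots> \<le> K * M * dist (x n s) (c n k s)"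
          using K_ge norm_e[OF elim(2)] by (intro mult_right_mono mult_left_mono) auto
        also have "\<dots> < K * M * (\<theta> / (3 * (K * M)))"
          using d KM by (intro mult_strict_left_mono) auto
        also have "\<dots> = \<theta> / 3"
          using KM K_ge M by simp
        finally have 1: "dist (?u (x n s)) (?u (c n k s)) < \<theta> / 3" .
        have "\<theta> / (3 * (K * M)) \<le> \<theta> / 3"
          using KM \<open>\<theta> > 0\<close> by (intro divide_left_mono) auto
        then have 2: "dist (c n k s) (x n s) < \<theta> / 3"
          using k[OF s] by linarith
        have 3: "dist (?u (c n k s)) (c n k s) < \<theta> / 3"
          using elim(1) s by blast
        show "dist (?u (x n s)) (x n s) < \<theta>"
          using 1 2 3 dist_triangle[of "?u (x n s)" "x n s" "?u (c n k s)"]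
            dist_triangle[of "?u (c n k s)" "x n s" "c n k s"] by linarith
      qed
    qed
  qed

  \<comment> \<open>Assembly of the conclusions\<close>
  have limits: "(\<lambda>k. \<pi> (inverse_element (b k) ^ n) s) \<longlonglongrightarrow> x n s" if "1 \<le> n" "s \<in> S" for n s
    using x_lim[OF that] by (simp add: inverse_b c_def)
  show ?thesis
    by (intro exI[of _ a] exI[of _ x] exI[of _ u] exI[of _ b] exI[of _ l] conjI)
      (rule a a_hull b_properties |
        use factor norm_a uc homeo near_id growth x_add x_scale l limits bounded_image
          totally_bounded_uniformly_continuous_image[OF uc] unif_image in \<open>simp add: u_def\<close>)+
qed

end
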